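(* Let $1\leq p\leq q<\infty$, let $E$ be a locally convex space, $L$ a Banach space, and let $T:E\to L$ be an operator. (i) $T$ is $U$-$(q,p)$-summing for some $U\in\mathcal{N}_0^c(E)$ if and only if $\hat T$ is well-defined and continuous. (ii) If $\hat T$ is continuous, then $T$ is $(q,p)$-convergent. (iii) If the space $\ell_p[E]$ is barrelled and $T$ is $(q,p)$-convergent, then $\hat T$ is continuous.
   Context: All locally convex spaces are Hausdorff, over $\mathbb{F}\in\{\mathbb{R},\mathbb{C}\}$. An operator is a continuous linear map. $\mathcal{N}_0^c(E)$ is the family of all closed absolutely convex neighborhoods of zero in $E$; $U^\circ=\{\chi\in E':|\langle\chi,x\rangle|\le1\ \forall x\in U\}$. A sequence $(x_n)_{n\in\omega}$ in $E$ is weakly $p$-summable if $(\langle\chi,x_n\rangle)_n\in\ell_p$ for every $\chi\in E'$; $\ell_p[E]$ is the vector space of all weakly $p$-summable sequences in $E$ with the locally convex topology generated by the seminorms $\rho_U((x_n))=\sup_{\chi\in U^\circ}\|(\langle\chi,x_n\rangle)_n\|_{\ell_p}$, $U\in\mathcal{N}_0^c(E)$. $\ell_q^s(L)$ is the Banach space of all sequences $(y_n)$ in $L$ with $(\|y_n\|)_n\in\ell_q$, with norm $\big(\sum_n\|y_n\|^q\big)^{1/q}$. The linear map $\hat T:\ell_p[E]\to\ell_q^s(L)$ associated with $T$ is $\hat T((y_n)_n)=(T(y_n))_n$; it is well-defined if this sequence lies in $\ell_q^s(L)$ for all $(y_n)\in\ell_p[E]$. ("$\hat T$ is continuous" includes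 that it is well-defined.) $T$ is $(q,p)$-convergent if $(\|T(x_n)\|)_n\in\ell_q$ for every weakly $p$-summable sequence $(x_n)$ in $E$. For an absolutely convex closed subset $U$ of $E$, $T$ is $U$-$(q,p)$-summing if there is a constant $C>0$ such that for every $n\in\omega$ and all $x_0,\dots,x_n\in U$, $$\Big(\sum_{i=0}^n\|T(x_i)\|^q\Big)^{1/q}\leq C\cdot\sup\Big\{\Big(\sum_{i=0}^n|\langle\chi,x_i\rangle|^p\Big)^{1/p}:\chi\in U^\circ\Big\}.$$ A locally convex space $F$ is barrelled if every $\sigma(F',F)$-bounded subset of $F'$ is equicontinuous. *)

theory Defs
  imports "HOL-Analysis.Analysis" "HOL-Library.Function_Algebras"
begin

text \<open>
  The scalar field is the field of real or of complex numbers, with its usual absolute value.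
\<close>

class real_or_complex = real_normed_field +
  assumes real_or_complex:
    "(\<forall>z. \<exists>a. z = a *\<^sub>R 1) \<or>
     (\<exists>i. i * i = - 1 \<and>
        (\<forall>z. \<exists>a b. z = a *\<^sub>R 1 + b *\<^sub>R i \<and> norm z = sqrt (a\<^sup>2 + b\<^sup>2)))"

instance real :: real_or_complex
  by standard simp

instance complex :: real_or_complex
proof
  have "\<exists>a b. z = a *\<^sub>R 1 + b *\<^sub>R \<i> \<and> norm z = sqrt (a\<^sup>2 + b\<^sup>2)" for z
    by (rule exI[of _ "Re z"], rule exI[of _ "Im z"]) (simp add: complex_eq_iff cmod_def)
  then show "(\<forall>z::complex. \<exists>a. z = a *\<^sub>R 1) \<or>
     (\<exists>i::complex. i * i = - 1 \<and>
        (\<forall>z. \<exists>a b. z = a *\<^sub>R 1 + b *\<^sub>R i \<and> norm z = sqrt (a\<^sup>2 + b\<^sup>2)))"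
    using i_squared by blast
qed

text \<open>
  A locally convex space is given by a topology \<open>X\<close> whose carrier \<open>topspace X\<close> is a linear
  subspace of an ambient vector space with scalar multiplication \<open>smul\<close>. Allowing a proper
  subspace as carrier lets spaces of sequences be treated on the same footing.
\<close>

locale locally_convex_space = vector_space smul
  for smul :: "'k::real_or_complex \<Rightarrow> 'e::ab_group_add \<Rightarrow> 'e" +
  fixes X :: "'e topology"
  assumes subspace_topspace: "subspace (topspace X)"
    and Hausdorff: "Hausdorff_space X"
    and continuous_add: "continuous_map (prod_topology X X) X (\<lambda>(x, y). x + y)"
    and continuous_smul: "continuous_map (prod_topology euclidean X) X (\<lambda>(c, x). smul c x)"
    and locally_convex:
      "\<lbrakk>openin X W; 0 \<in> W\<rbrakk> \<Longrightarrow>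
        \<exists>C V. openin X V \<and> 0 \<in> V \<and> V \<subseteq> C \<and> C \<subseteq> W \<and>
          (\<forall>x\<in>C. \<forall>y\<in>C. \<forall>t\<in>{0..1}. smul (of_real (1 - t)) x + smul (of_real t) y \<in> C)"

text \<open>
  A Banach space over \<open>'k\<close>: the type class provides the complete norm and the underlying real
  vector space structure, which \<open>smul\<close> extends to the scalars \<open>'k\<close>.
\<close>

locale banach_space_over = vector_space smul
  for smul :: "'k::real_or_complex \<Rightarrow> 'l::banach \<Rightarrow> 'l" +
  assumes smul_of_real: "smul (of_real r) x = r *\<^sub>R x"
    and norm_smul: "norm (smul c x) = norm c * norm x"

definition is_operator ::
  "('k \<Rightarrow> 'e \<Rightarrow> 'e) \<Rightarrow> 'e topology \<Rightarrow> ('k \<Rightarrow> 'f \<Rightarrow> 'f) \<Rightarrow> 'f topology \<Rightarrow>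
    ('e::ab_group_add \<Rightarrow> 'f::ab_group_add) \<Rightarrow> bool"
  where "is_operator smul X smul' Y T \<longleftrightarrow>
    continuous_map X Y T \<and>
    (\<forall>x\<in>topspace X. \<forall>y\<in>topspace X. T (x + y) = T x + T y) \<and>
    (\<forall>c. \<forall>x\<in>topspace X. T (smul c x) = smul' c (T x))"

text \<open>
  The topological dual. Its members are total functions whose values outside \<open>topspace X\<close> are
  arbitrary, and no definition below depends on those values.
\<close>

definition dual :: "('k::real_or_complex \<Rightarrow> 'e \<Rightarrow> 'e) \<Rightarrow> 'e::ab_group_add topology \<Rightarrow> ('e \<Rightarrow> 'k) set"
  where "dual smul X = {\<phi>. is_operator smul X (*) euclidean \<phi>}"

definition absolutely_convex ::
  "('k::real_or_complex \<Rightarrow> 'e \<Rightarrow> 'e) \<Rightarrow> 'e::ab_group_add set \<Rightarrow> bool"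
  where "absolutely_convex smul U \<longleftrightarrow>
    (\<forall>x\<in>U. \<forall>y\<in>U. \<forall>a b. norm a + norm b \<le> 1 \<longrightarrow> smul a x + smul b y \<in> U)"

definition closed_ac_nhds_0 ::
  "('k::real_or_complex \<Rightarrow> 'e \<Rightarrow> 'e) \<Rightarrow> 'e::ab_group_add topology \<Rightarrow> 'e set set"
  where "closed_ac_nhds_0 smul X =
    {U. closedin X U \<and> absolutely_convex smul U \<and> (\<exists>V. openin X V \<and> 0 \<in> V \<and> V \<subseteq> U)}"

definition polar ::
  "('k::real_or_complex \<Rightarrow> 'e \<Rightarrow> 'e) \<Rightarrow> 'e::ab_group_add topology \<Rightarrow> 'e set \<Rightarrow> ('e \<Rightarrow> 'k) set"
  where "polar smul X U = {\<phi> \<in> dual smul X. \<forall>x\<in>U. norm (\<phi> x) \<le> 1}"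

text \<open>
  Boundedness for the weak-star topology, which is generated by the seminorms
  \<open>\<phi> \<mapsto> norm (\<phi> x)\<close>, is boundedness of each of these seminorms.
\<close>

definition weak_star_bounded :: "'e topology \<Rightarrow> ('e \<Rightarrow> 'k::real_or_complex) set \<Rightarrow> bool"
  where "weak_star_bounded X B \<longleftrightarrow> (\<forall>x\<in>topspace X. \<exists>M. \<forall>\<phi>\<in>B. norm (\<phi> x) \<le> M)"

definition equicontinuous :: "'e topology \<Rightarrow> ('e \<Rightarrow> 'k::real_or_complex) set \<Rightarrow> bool"
  where "equicontinuous X B \<longleftrightarrow>
    (\<forall>x\<in>topspace X. \<forall>\<epsilon>>0. \<exists>V. openin X V \<and> x \<in> V \<and>
      (\<forall>y\<in>V. \<forall>\<phi>\<in>B. dist (\<phi> y) (\<phi> x) < \<epsilon>))"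

definition barrelled ::
  "('k::real_or_complex \<Rightarrow> 'e \<Rightarrow> 'e) \<Rightarrow> 'e::ab_group_add topology \<Rightarrow> bool"
  where "barrelled smul X \<longleftrightarrow>
    (\<forall>B \<subseteq> dual smul X. weak_star_bounded X B \<longrightarrow> equicontinuous X B)"

text \<open>
  The topology generated by a family \<open>P\<close> of seminorms on \<open>V\<close>. Adding \<open>V\<close> to the subbase ensures
  that the carrier is \<open>V\<close> also when \<open>P\<close> is empty.
\<close>

definition seminorm_topology :: "'v::ab_group_add set \<Rightarrow> ('v \<Rightarrow> real) set \<Rightarrow> 'v topology"
  where "seminorm_topology V P =
    topology_generated_by (insert V {{y \<in> V. \<rho> (y - x) < \<epsilon>} | x \<rho> \<epsilon>. x \<in> V \<and> \<rho> \<in> P \<and> \<epsilon> > 0})"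

lemma topspace_seminorm_topology [simp]: "topspace (seminorm_topology V P) = V"
  unfolding seminorm_topology_def topology_generated_by_topspace by auto

definition seq_smul :: "('k \<Rightarrow> 'e \<Rightarrow> 'e) \<Rightarrow> 'k \<Rightarrow> (nat \<Rightarrow> 'e) \<Rightarrow> (nat \<Rightarrow> 'e)"
  where "seq_smul smul c x = (\<lambda>n. smul c (x n))"

definition weakly_summable_seqs ::
  "('k::real_or_complex \<Rightarrow> 'e \<Rightarrow> 'e) \<Rightarrow> 'e::ab_group_add topology \<Rightarrow> real \<Rightarrow> (nat \<Rightarrow> 'e) set"
  where "weakly_summable_seqs smul X p =
    {x. (\<forall>n. x n \<in> topspace X) \<and>
        (\<forall>\<phi>\<in>dual smul X. summable (\<lambda>n. norm (\<phi> (x n)) powr p))}"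

text \<open>
  For weakly \<open>p\<close>-summable \<open>x\<close> and a closed absolutely convex neighborhood \<open>U\<close> of zero the supremum
  is over a nonempty set, which is bounded by the uniform boundedness principle (the span of the
  polar, normed by its gauge, is a Banach space).
\<close>

definition weak_seminorm ::
  "('k::real_or_complex \<Rightarrow> 'e \<Rightarrow> 'e) \<Rightarrow> 'e::ab_group_add topology \<Rightarrow> real \<Rightarrow> 'e set \<Rightarrow> (nat \<Rightarrow> 'e) \<Rightarrow> real"
  where "weak_seminorm smul X p U x =
    (SUP \<phi>\<in>polar smul X U. (\<Sum>n. norm (\<phi> (x n)) powr p) powr (1 / p))"

definition weak_lp ::
  "('k::real_or_complex \<Rightarrow> 'e \<Rightarrow> 'e) \<Rightarrow> 'e::ab_group_add topology \<Rightarrow> real \<Rightarrow> (nat \<Rightarrow> 'e) topology"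
  where "weak_lp smul X p =
    seminorm_topology (weakly_summable_seqs smul X p)
      (weak_seminorm smul X p ` closed_ac_nhds_0 smul X)"

definition strongly_summable_seqs :: "real \<Rightarrow> (nat \<Rightarrow> 'l::banach) set"
  where "strongly_summable_seqs q = {y. summable (\<lambda>n. norm (y n) powr q)}"

definition strong_norm :: "real \<Rightarrow> (nat \<Rightarrow> 'l::banach) \<Rightarrow> real"
  where "strong_norm q y = (\<Sum>n. norm (y n) powr q) powr (1 / q)"

definition strong_lq :: "real \<Rightarrow> (nat \<Rightarrow> 'l::banach) topology"
  where "strong_lq q = seminorm_topology (strongly_summable_seqs q) {strong_norm q}"

definition hat :: "('e \<Rightarrow> 'l) \<Rightarrow> (nat \<Rightarrow> 'e) \<Rightarrow> (nat \<Rightarrow> 'l)"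
  where "hat T y = (\<lambda>n. T (y n))"

definition qp_convergent ::
  "('k::real_or_complex \<Rightarrow> 'e \<Rightarrow> 'e) \<Rightarrow> 'e::ab_group_add topology \<Rightarrow> real \<Rightarrow> real \<Rightarrow> ('e \<Rightarrow> 'l::banach) \<Rightarrow> bool"
  where "qp_convergent smul X q p T \<longleftrightarrow>
    (\<forall>x\<in>weakly_summable_seqs smul X p. summable (\<lambda>n. norm (T (x n)) powr q))"

definition U_qp_summing ::
  "('k::real_or_complex \<Rightarrow> 'e \<Rightarrow> 'e) \<Rightarrow> 'e::ab_group_add topology \<Rightarrow> 'e set \<Rightarrow> real \<Rightarrow> real \<Rightarrow>
    ('e \<Rightarrow> 'l::banach) \<Rightarrow> bool"
  where "U_qp_summing smul X U q p T \<longleftrightarrow>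
    (\<exists>C>0. \<forall>n. \<forall>x::nat \<Rightarrow> 'e. (\<forall>i\<le>n. x i \<in> U) \<longrightarrow>
      (\<Sum>i\<le>n. norm (T (x i)) powr q) powr (1 / q)
        \<le> C * (SUP \<phi>\<in>polar smul X U. (\<Sum>i\<le>n. norm (\<phi> (x i)) powr p) powr (1 / p)))"

end

theory Submission
  imports Defs
begin

text \<open>
  Everything reduces to the estimate that the \<open>\<ell>\<^sub>q\<close>-norm of \<open>hat T y\<close> is at most \<open>C * \<rho> U y\<close> for
  some neighborhood \<open>U\<close> and constant \<open>C\<close>, where \<open>\<rho> U\<close> is the seminorm of \<open>\<ell>\<^sub>p[E]\<close> that belongs to
  \<open>U\<close> (\<open>hat_bounded\<close>). The seminorms \<open>\<rho> U\<close> are directed, because \<open>\<rho> (U \<inter> W)\<close> dominates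
  \<open>\<rho> U\<close> and \<open>\<rho> W\<close>; so this estimate is the usual criterion for continuity of \<open>hat T\<close>
  (\<open>continuous_hat_iff\<close>). For finitely supported sequences it is, up to
  scaling, the summing inequality, and it extends back from initial segments to whole sequences
  (\<open>hat_bounded_iff_summing\<close>). Convergence of \<open>T\<close> says exactly that \<open>hat T\<close> is well defined, which
  is part of continuity.

  That \<open>\<rho> U\<close> is a finite supremum is a uniform boundedness theorem. It is proved directly for sets
  of scalar sequences that are closed under countable absolutely convex combinations
  (\<open>bounded_if_countably_absolutely_convex\<close>), such as the set of the sequences of values
  \<open>\<phi> (x n)\<close> for \<open>\<phi>\<close> in the polar of \<open>U\<close>.

  In the barrelled case, barrelledness has to be fed with a set of functionals on \<open>\<ell>\<^sub>p[E]\<close> whose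
  supremum is the norm of \<open>hat T\<close>. The Hahn--Banach theorem (\<open>seminorm_Hahn_Banach\<close>) provides
  it, applied to the norms of the initial segments of \<open>hat T y\<close>, which are continuous seminorms
  (\<open>barrelled_imp_hat_bounded\<close>). The Hahn--Banach theorem itself follows from the existence of
  minimal sublinear functionals.
\<close>

section \<open>Sequences with summable powers\<close>

abbreviation lp_summable :: "real \<Rightarrow> (nat \<Rightarrow> 'a::real_normed_vector) \<Rightarrow> bool"
  where "lp_summable p a \<equiv> summable (\<lambda>n. norm (a n) powr p)"

definition lp_norm :: "real \<Rightarrow> (nat \<Rightarrow> 'a::real_normed_vector) \<Rightarrow> real"
  where "lp_norm p a = (\<Sum>n. norm (a n) powr p) powr (1 / p)"

definition trunc :: "nat \<Rightarrow> (nat \<Rightarrow> 'a::zero) \<Rightarrow> nat \<Rightarrow> 'a"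
  where "trunc N a = (\<lambda>n. if n < N then a n else 0)"

lemma lp_norm_nonneg [simp]: "0 \<le> lp_norm p a"
  by (simp add: lp_norm_def)

lemma lp_norm_powr:
  assumes "p > 0" "lp_summable p a"
  shows "lp_norm p a powr p = (\<Sum>n. norm (a n) powr p)"
  using assms by (simp add: lp_norm_def powr_powr suminf_nonneg)

lemma sum_le_lp_norm:
  assumes "p > 0" "lp_summable p a" "finite F"
  shows "(\<Sum>n\<in>F. norm (a n) powr p) \<le> lp_norm p a powr p"
  using assms by (simp add: lp_norm_powr sum_le_suminf)

lemma norm_le_lp_norm:
  assumes "p > 0" "lp_summable p a"
  shows "norm (a n) \<le> lp_norm p a"
proof -
  have "norm (a n) powr p \<le> lp_norm p a powr p"
    using sum_le_lp_norm[OF assms, of "{n}"] by simp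
  then show ?thesis
    using powr_less_mono2[OF assms(1) lp_norm_nonneg] by (meson not_le)
qed

lemma lp_norm_leI:
  assumes "p > 0" "C \<ge> 0" "\<And>n. (\<Sum>i<n. norm (a i) powr p) \<le> C powr p"
  shows "lp_summable p a" and "lp_norm p a \<le> C"
proof -
  show s: "lp_summable p a"
    by (rule summableI_nonneg_bounded[where x = "C powr p"]) (use assms in auto)
  have "(\<Sum>n. norm (a n) powr p) \<le> C powr p"
    by (rule suminf_le_const[OF s]) (use assms in auto)
  then have "lp_norm p a \<le> (C powr p) powr (1 / p)"
    unfolding lp_norm_def using assms(1) s by (intro powr_mono2) (auto intro: suminf_nonneg)
  then show "lp_norm p a \<le> C"
    using assms by (simp add: powr_powr)
qed

lemma lp_mono:
  assumes "p > 0" "lp_summable p b" "\<And>n. norm (a n) \<le> norm (b n)"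
  shows "lp_summable p a" and "lp_norm p a \<le> lp_norm p b"
proof -
  have "(\<Sum>i<n. norm (a i) powr p) \<le> lp_norm p b powr p" for n
  proof -
    have "(\<Sum>i<n. norm (a i) powr p) \<le> (\<Sum>i<n. norm (b i) powr p)"
      using assms by (intro sum_mono powr_mono2) auto
    also have "\<dots> \<le> lp_norm p b powr p"
      using assms by (intro sum_le_lp_norm) auto
    finally show ?thesis .
  qed
  then show "lp_summable p a" "lp_norm p a \<le> lp_norm p b"
    using lp_norm_leI[OF assms(1) lp_norm_nonneg] by blast+
qed

lemma lp_scale:
  assumes "p > 0" "c \<ge> 0" "\<And>n. norm (b n) = c * norm (a n)"
  shows "lp_summable p a \<Longrightarrow> lp_summable p b"
    and "lp_summable p a \<Longrightarrow> lp_norm p b = c * lp_norm p a"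
  using assms
  by (simp_all add: lp_norm_def powr_mult suminf_mult suminf_nonneg powr_powr)

lemma lp_finite_support:
  assumes "finite F" "\<And>n. n \<notin> F \<Longrightarrow> a n = 0"
  shows "lp_summable p a" and "lp_norm p a = (\<Sum>n\<in>F. norm (a n) powr p) powr (1 / p)"
  using assms by (auto simp: lp_norm_def suminf_finite intro!: summable_finite)

lemma lp_summable_trunc [simp]: "lp_summable p (trunc N a)"
  by (rule lp_finite_support(1)[of "{..<N}"]) (auto simp: trunc_def)

lemma lp_norm_trunc: "lp_norm p (trunc N a) = (\<Sum>n<N. norm (a n) powr p) powr (1 / p)"
  by (subst lp_finite_support(2)[of "{..<N}"]) (auto simp: trunc_def)

lemma lp_norm_trunc_le:
  assumes "p > 0" "lp_summable p a"
  shows "lp_norm p (trunc N a) \<le> lp_norm p a"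
  by (rule lp_mono(2)) (use assms in \<open>auto simp: trunc_def\<close>)

lemma lp_norm_le_if_trunc_le:
  assumes "p > 0" "\<And>N. lp_norm p (trunc N a) \<le> C"
  shows "lp_summable p a" and "lp_norm p a \<le> C"
proof -
  have C: "0 \<le> C"
    using assms(2)[of 0] lp_norm_nonneg order_trans by blast
  have "(\<Sum>i<n. norm (a i) powr p) \<le> C powr p" for n
  proof -
    have "(\<Sum>i<n. norm (a i) powr p) = lp_norm p (trunc n a) powr p"
      using assms(1) by (simp add: lp_norm_trunc powr_powr sum_nonneg)
    also have "\<dots> \<le> C powr p"
      using assms by (intro powr_mono2) auto
    finally show ?thesis .
  qed
  then show "lp_summable p a" "lp_norm p a \<le> C"
    using lp_norm_leI[OF assms(1) C] by blast+
qed

text \<open>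
  Convexity of \<open>t \<mapsto> t\<^sup>p\<close> on the closed half-line. If one of the points is \<open>0\<close>, it
  reduces to \<open>t\<^sup>p \<le> t\<close> for \<open>0 < t < 1\<close>.
\<close>

lemma powr_convex_combination:
  fixes u v s t p :: real
  assumes "p \<ge> 1" "u \<ge> 0" "v \<ge> 0" "s > 0" "t > 0" "s + t = 1"
  shows "(s * u + t * v) powr p \<le> s * u powr p + t * v powr p"
proof -
  have le: "r powr p \<le> r" if "0 < r" "r < 1" for r :: real
    using powr_mono'[OF assms(1), of r] that by simp
  consider "u = 0" | "v = 0" | "u > 0" "v > 0"
    using assms by force
  then show ?thesis
  proof cases
    case 1
    then show ?thesis
      using le[of t] assms by (simp add: powr_mult mult_right_mono)
  next
    case 2
    then show ?thesis
      using le[of s] assms by (simp add: powr_mult mult_right_mono)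
  next
    case 3
    then show ?thesis
      using convex_onD[OF powr_convex[OF assms(1)], of t u v] assms
      by (simp add: eq_diff_eq[symmetric])
  qed
qed

text \<open>
  Minkowski's inequality: if \<open>A\<close> and \<open>B\<close> exceed the two norms, then
  \<open>(a + b) / (A + B)\<close> is a convex combination of \<open>a / A\<close> and \<open>b / B\<close>, and convexity of
  \<open>t \<mapsto> t\<^sup>p\<close> bounds its \<open>p\<close>-sums by 1. Taking \<open>A\<close> and \<open>B\<close> strictly larger than the norms avoids
  division by zero.
\<close>

lemma lp_add:
  assumes p: "p \<ge> 1" and a: "lp_summable p a" and b: "lp_summable p b"
  shows "lp_summable p (\<lambda>n. a n + b n)"
    and "lp_norm p (\<lambda>n. a n + b n) \<le> lp_norm p a + lp_norm p b"
proof -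
  have main: "lp_summable p (\<lambda>n. a n + b n) \<and> lp_norm p (\<lambda>n. a n + b n) \<le> A + B"
    if A: "A > lp_norm p a" and B: "B > lp_norm p b" for A B
  proof -
    have pos: "A > 0" "B > 0"
      using A B lp_norm_nonneg[of p a] lp_norm_nonneg[of p b] by linarith+
    define s t where "s = A / (A + B)" and "t = B / (A + B)"
    have st: "s > 0" "t > 0" "s + t = 1"
      using pos by (auto simp: s_def t_def divide_simps)
    have "(\<Sum>i<n. norm (a i + b i) powr p) \<le> (A + B) powr p" for n
    proof -
      have summand: "norm (a i + b i) powr p
          \<le> (A + B) powr p * (s * (norm (a i) powr p / A powr p) + t * (norm (b i) powr p / B powr p))" for i
      proof -
        have eq: "norm (a i) + norm (b i) = (A + B) * (s * (norm (a i) / A) + t * (norm (b i) / B))"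
        proof -
          have "(A + B) * s = A" "(A + B) * t = B"
            using pos by (simp_all add: s_def t_def)
          then show ?thesis
            using pos by (simp add: distrib_left mult.assoc[symmetric])
        qed
        have "norm (a i + b i) powr p \<le> (norm (a i) + norm (b i)) powr p"
          using p by (intro powr_mono2 norm_triangle_ineq) auto
        also have "\<dots> = (A + B) powr p * (s * (norm (a i) / A) + t * (norm (b i) / B)) powr p"
          unfolding eq using pos st by (subst powr_mult) auto
        also have "\<dots> \<le> (A + B) powr p * (s * (norm (a i) / A) powr p + t * (norm (b i) / B) powr p)"
          using pos st p by (intro mult_left_mono powr_convex_combination) auto
        finally show ?thesis
          using pos by (simp add: powr_divide)
      qed
      have part: "(\<Sum>i<n. norm (c i) powr p) / D powr p \<le> 1"
        if "lp_summable p c" "lp_norm p c < D" for c :: "nat \<Rightarrow> 'a" and D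
      proof -
        have "(\<Sum>i<n. norm (c i) powr p) \<le> lp_norm p c powr p"
          using that p by (intro sum_le_lp_norm) auto
        also have "\<dots> \<le> D powr p"
          using that p by (intro powr_mono2) auto
        finally show ?thesis
          by (simp add: divide_le_eq_1)
      qed
      have "(\<Sum>i<n. norm (a i + b i) powr p)
          \<le> (\<Sum>i<n. (A + B) powr p * (s * (norm (a i) powr p / A powr p) + t * (norm (b i) powr p / B powr p)))"
        by (rule sum_mono) (rule summand)
      also have "\<dots> = (A + B) powr p * (s * ((\<Sum>i<n. norm (a i) powr p) / A powr p)
          + t * ((\<Sum>i<n. norm (b i) powr p) / B powr p))"
        by (simp add: sum_distrib_left sum.distrib sum_divide_distrib algebra_simps)
      also have "\<dots> \<le> (A + B) powr p * (s * 1 + t * 1)"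
        using st part[OF a A] part[OF b B]
        by (intro mult_left_mono add_mono) auto
      finally show ?thesis
        using st by simp
    qed
    then show ?thesis
      using lp_norm_leI[of p "A + B" "\<lambda>n. a n + b n"] p pos by auto
  qed
  show "lp_summable p (\<lambda>n. a n + b n)"
    using main[of "lp_norm p a + 1" "lp_norm p b + 1"] by simp
  show "lp_norm p (\<lambda>n. a n + b n) \<le> lp_norm p a + lp_norm p b"
  proof (rule field_le_epsilon)
    fix e :: real assume "e > 0"
    then show "lp_norm p (\<lambda>n. a n + b n) \<le> lp_norm p a + lp_norm p b + e"
      using main[of "lp_norm p a + e / 2" "lp_norm p b + e / 2"] by simp
  qed
qed

lemma lp_diff:
  assumes "p \<ge> 1" "lp_summable p a" "lp_summable p b"
  shows "lp_summable p (\<lambda>n. a n - b n)"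
    and "lp_norm p (\<lambda>n. a n - b n) \<le> lp_norm p a + lp_norm p b"
proof -
  have "lp_norm p (\<lambda>n. - b n) = lp_norm p b"
    by (simp add: lp_norm_def)
  then show "lp_summable p (\<lambda>n. a n - b n)"
    "lp_norm p (\<lambda>n. a n - b n) \<le> lp_norm p a + lp_norm p b"
    using lp_add[OF assms(1,2), of "\<lambda>n. - b n"] assms(3) by simp_all
qed

section \<open>Real and complex scalars\<close>

text \<open>
  Real multiples of \<open>i\<close> have squares at most zero, so only zero is both real and such a multiple,
  and the decomposition of a scalar into real and imaginary part is unique. Hence
  the norm formula, which is assumed for some decomposition of each scalar, holds for every one.
\<close>

lemma norm_real_plus_imaginary:
  fixes i :: "'k::real_or_complex"
  assumes i: "i * i = - 1"
    and rep: "\<forall>z. \<exists>a b. z = a *\<^sub>R 1 + b *\<^sub>R i \<and> norm z = sqrt (a\<^sup>2 + b\<^sup>2)"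
  shows "norm (of_real a + of_real b * i :: 'k) = sqrt (a\<^sup>2 + b\<^sup>2)"
proof -
  obtain a' b' where ab: "of_real a + of_real b * i = of_real a' + of_real b' * i"
      "norm (of_real a + of_real b * i) = sqrt (a'\<^sup>2 + b'\<^sup>2)"
    using rep[rule_format, of "of_real a + of_real b * i"] by (auto simp: scaleR_conv_of_real)
  have "of_real (a - a') = of_real (b' - b) * i"
    using ab(1) by (simp add: algebra_simps)
  then have "of_real (a - a') * of_real (a - a') = (of_real (b' - b) * i) * (of_real (b' - b) * i)"
    by simp
  also have "\<dots> = - (of_real (b' - b) * of_real (b' - b))"
    using arg_cong[OF i, of "\<lambda>z. of_real (b' - b) * of_real (b' - b) * z"] by (simp add: mult_ac)
  finally have "(of_real ((a - a') * (a - a') + (b' - b) * (b' - b)) :: 'k) = 0"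
    by simp
  then have "(a - a') * (a - a') + (b' - b) * (b' - b) = 0"
    by (simp only: of_real_eq_0_iff)
  then have "a = a'" "b = b'"
    by (auto simp: sum_squares_eq_zero_iff)
  then show ?thesis
    using ab(2) by simp
qed

text \<open>
  The scalar field is complete, which is what makes absolutely convergent series of scalars
  converge: their real and imaginary parts are absolutely convergent real series.
\<close>

lemma summable_scalar_norm_cancel:
  fixes f :: "nat \<Rightarrow> 'k::real_or_complex"
  assumes "summable (\<lambda>n. norm (f n))"
  shows "summable f"
  using real_or_complex[where 'a = 'k]
proof
  assume "\<forall>z::'k. \<exists>a. z = a *\<^sub>R 1"
  then have "\<forall>n. \<exists>a. f n = of_real a"
    unfolding of_real_def by blast
  then obtain g where g: "\<And>n. f n = of_real (g n)"
    using choice[of "\<lambda>n a. f n = of_real a"] by blast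
  then have "summable (\<lambda>n. norm (g n))"
    using assms by simp
  then show ?thesis
    using summable_norm_cancel summable_of_real unfolding g by blast
next
  assume "\<exists>i::'k. i * i = - 1 \<and>
        (\<forall>z. \<exists>a b. z = a *\<^sub>R 1 + b *\<^sub>R i \<and> norm z = sqrt (a\<^sup>2 + b\<^sup>2))"
  then obtain i :: 'k where i: "i * i = - 1"
      "\<forall>z. \<exists>a b. z = a *\<^sub>R 1 + b *\<^sub>R i \<and> norm z = sqrt (a\<^sup>2 + b\<^sup>2)"
    by blast
  then have "\<forall>n. \<exists>c. f n = of_real (fst c) + of_real (snd c) * i \<and>
      norm (f n) = sqrt ((fst c)\<^sup>2 + (snd c)\<^sup>2)"
    by (simp add: scaleR_conv_of_real)
  from choice[OF this] obtain c where c: "\<And>n. f n = of_real (fst (c n)) + of_real (snd (c n)) * i"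
      "\<And>n. norm (f n) = sqrt ((fst (c n))\<^sup>2 + (snd (c n))\<^sup>2)"
    by blast
  define a b where "a = (\<lambda>n. fst (c n))" and "b = (\<lambda>n. snd (c n))"
  have f: "\<And>n. f n = of_real (a n) + of_real (b n) * i"
      "\<And>n. norm (f n) = sqrt ((a n)\<^sup>2 + (b n)\<^sup>2)"
    unfolding a_def b_def by (fact c)+
  have "summable a" "summable b"
    by (rule summable_comparison_test'[OF assms], simp add: f(2))+
  then show ?thesis
    unfolding f(1) by (intro summable_add summable_mult2 summable_of_real)
qed

section \<open>The Hahn--Banach theorem\<close>

definition sublinear_on :: "(real \<Rightarrow> 'v \<Rightarrow> 'v) \<Rightarrow> 'v::ab_group_add set \<Rightarrow> ('v \<Rightarrow> real) \<Rightarrow> bool"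
  where "sublinear_on sc V f \<longleftrightarrow>
    (\<forall>x\<in>V. \<forall>y\<in>V. f (x + y) \<le> f x + f y) \<and> (\<forall>x\<in>V. \<forall>r>0. f (sc r x) \<le> r * f x)"

locale real_subspace = vector_space sc
  for sc :: "real \<Rightarrow> 'v::ab_group_add \<Rightarrow> 'v" +
  fixes V :: "'v set"
  assumes V: "subspace V"
begin

lemma V_closed:
  shows "0 \<in> V" "\<lbrakk>x \<in> V; y \<in> V\<rbrakk> \<Longrightarrow> x + y \<in> V" "x \<in> V \<Longrightarrow> sc r x \<in> V" "x \<in> V \<Longrightarrow> - x \<in> V"
  using V by (simp_all add: subspace_0 subspace_add subspace_scale subspace_neg)

lemma sublinear_add: "\<lbrakk>sublinear_on sc V f; x \<in> V; y \<in> V\<rbrakk> \<Longrightarrow> f (x + y) \<le> f x + f y"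
  by (simp add: sublinear_on_def)

lemma sublinear_scale:
  assumes f: "sublinear_on sc V f" and x: "x \<in> V" and "r > 0"
  shows "f (sc r x) = r * f x"
proof (rule antisym)
  show "f (sc r x) \<le> r * f x"
    using assms by (simp add: sublinear_on_def)
  have "f (sc (1 / r) (sc r x)) \<le> (1 / r) * f (sc r x)"
    using f \<open>r > 0\<close> V_closed(3)[OF x] unfolding sublinear_on_def by (metis zero_less_divide_1_iff)
  then show "r * f x \<le> f (sc r x)"
    using assms by (simp add: field_simps)
qed

lemma sublinear_0:
  assumes "sublinear_on sc V f"
  shows "f 0 = 0"
  using sublinear_scale[OF assms V_closed(1), of 2] by simp

lemma sublinear_neg:
  assumes "sublinear_on sc V f" "x \<in> V"
  shows "- f (- x) \<le> f x"
  using sublinear_add[OF assms V_closed(4)[OF assms(2)]] sublinear_0[OF assms(1)] by simp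

text \<open>
  The largest sublinear functional \<open>g \<le> f\<close> with \<open>g (- z) \<le> - f z\<close>. It is used twice: to show that
  a minimal sublinear functional is linear, and to prescribe the value at \<open>z\<close>. The value \<open>0\<close> off
  \<open>V\<close> is a default.
\<close>

definition tilt :: "('v \<Rightarrow> real) \<Rightarrow> 'v \<Rightarrow> 'v \<Rightarrow> real"
  where "tilt f z x = (if x \<in> V then INF t\<in>{0..}. f (x + sc t z) - t * f z else 0)"

context
  fixes f z
  assumes f: "sublinear_on sc V f" and z: "z \<in> V"
begin

lemma tilt_lower_bound:
  assumes "x \<in> V" "t \<ge> 0"
  shows "- f (- x) \<le> f (x + sc t z) - t * f z"
proof -
  have "t * f z = f (sc t z)"
    using sublinear_scale[OF f z] sublinear_0[OF f] assms by (cases "t = 0") auto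
  also have "\<dots> = f ((x + sc t z) + (- x))"
    by simp
  also have "\<dots> \<le> f (x + sc t z) + f (- x)"
    using assms z V_closed by (intro sublinear_add[OF f]) auto
  finally show ?thesis by simp
qed

lemma tilt_le:
  assumes "x \<in> V" "t \<ge> 0"
  shows "tilt f z x \<le> f (x + sc t z) - t * f z"
  unfolding tilt_def using assms tilt_lower_bound[OF assms(1)]
  by (auto intro!: cINF_lower bdd_belowI[where m = "- f (- x)"])

lemma tilt_greatest:
  assumes "x \<in> V" "\<And>t. t \<ge> 0 \<Longrightarrow> m \<le> f (x + sc t z) - t * f z"
  shows "m \<le> tilt f z x"
  unfolding tilt_def using assms by (auto intro!: cINF_greatest)

lemma tilt_le_self: "x \<in> V \<Longrightarrow> tilt f z x \<le> f x"
  using tilt_le[of x 0] by simp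

lemma tilt_neg_le: "tilt f z (- z) \<le> - f z"
  using tilt_le[of "- z" 1] V_closed z sublinear_0[OF f] by simp

lemma sublinear_tilt: "sublinear_on sc V (tilt f z)"
  unfolding sublinear_on_def
proof (intro conjI ballI allI impI)
  fix x y assume xy: "x \<in> V" "y \<in> V"
  have main: "tilt f z (x + y) \<le> (f (x + sc t z) - t * f z) + (f (y + sc u z) - u * f z)"
    if tu: "t \<ge> 0" "u \<ge> 0" for t u
  proof -
    have "tilt f z (x + y) \<le> f (x + y + sc (t + u) z) - (t + u) * f z"
      using xy tu V_closed by (intro tilt_le) auto
    also have "x + y + sc (t + u) z = (x + sc t z) + (y + sc u z)"
      by (simp add: scale_left_distrib)
    also have "f \<dots> \<le> f (x + sc t z) + f (y + sc u z)"
      using xy z V_closed by (intro sublinear_add[OF f]) auto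
    finally show ?thesis by (simp add: algebra_simps)
  qed
  have "tilt f z (x + y) - (f (x + sc t z) - t * f z) \<le> tilt f z y" if "t \<ge> 0" for t
    using main[OF that] xy by (intro tilt_greatest) (auto simp: algebra_simps)
  then have "tilt f z (x + y) - tilt f z y \<le> tilt f z x"
    using xy by (intro tilt_greatest) (auto simp: algebra_simps)
  then show "tilt f z (x + y) \<le> tilt f z x + tilt f z y"
    by simp
next
  fix x and r :: real assume x: "x \<in> V" and r: "r > 0"
  have "tilt f z (sc r x) / r \<le> tilt f z x"
  proof (rule tilt_greatest[OF x])
    fix t :: real assume t: "t \<ge> 0"
    have "tilt f z (sc r x) \<le> f (sc r x + sc (r * t) z) - (r * t) * f z"
      using x t r V_closed by (intro tilt_le) auto
    also have "sc r x + sc (r * t) z = sc r (x + sc t z)"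
      by (simp add: scale_right_distrib)
    also have "f \<dots> = r * f (x + sc t z)"
      using x z r V_closed by (intro sublinear_scale[OF f]) auto
    finally show "tilt f z (sc r x) / r \<le> f (x + sc t z) - t * f z"
      using r by (simp add: field_simps)
  qed
  then show "tilt f z (sc r x) \<le> r * tilt f z x"
    using r by (simp add: field_simps)
qed

end

text \<open>
  By Zorn's lemma. The pointwise infimum of a chain is finite because every sublinear \<open>g \<le> f\<close>
  satisfies \<open>g x \<ge> - f (- x)\<close>, and it is subadditive because of any two members of the chain
  one lies below the other. The members of the ordered set vanish off \<open>V\<close>, which makes the
  pointwise order antisymmetric.
\<close>

lemma minimal_sublinear_exists:
  assumes f: "sublinear_on sc V f"
  obtains m where "sublinear_on sc V m" "\<And>x. x \<in> V \<Longrightarrow> m x \<le> f x"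
    "\<And>g. \<lbrakk>sublinear_on sc V g; \<And>x. x \<in> V \<Longrightarrow> g x \<le> m x\<rbrakk> \<Longrightarrow> \<forall>x\<in>V. g x = m x"
proof -
  define A where "A = {g. sublinear_on sc V g \<and> (\<forall>x\<in>V. g x \<le> f x) \<and> (\<forall>x. x \<notin> V \<longrightarrow> g x = 0)}"
  define P :: "('v \<Rightarrow> real) \<Rightarrow> ('v \<Rightarrow> real) \<Rightarrow> bool" where "P a b \<longleftrightarrow> (\<forall>x. b x \<le> a x)" for a b
  have cut: "(\<lambda>x. if x \<in> V then g x else 0) \<in> A"
    if "sublinear_on sc V g" "\<And>x. x \<in> V \<Longrightarrow> g x \<le> f x" for g
    using that V_closed by (simp add: A_def sublinear_on_def)
  have "\<exists>m\<in>A. \<forall>a\<in>A. P m a \<longrightarrow> a = m"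
  proof (rule predicate_Zorn)
    show "partial_order_on A (relation_of P A)"
      by (rule partial_order_on_relation_ofI) (auto simp: P_def fun_eq_iff intro: order_trans antisym)
    fix C assume C: "C \<in> Chains (relation_of P A)"
    then have CA: "C \<subseteq> A" and total: "\<And>g h. \<lbrakk>g \<in> C; h \<in> C\<rbrakk> \<Longrightarrow> P g h \<or> P h g"
      by (auto simp: Chains_def relation_of_def)
    show "\<exists>u\<in>A. \<forall>a\<in>C. P a u"
    proof (cases "C = {}")
      case True
      then show ?thesis using cut[OF f] by blast
    next
      case False
      define u where "u = (\<lambda>x. INF g\<in>C. g x)"
      have low: "- f (- x) \<le> g x" if "g \<in> C" "x \<in> V" for g x
      proof -
        have "g (- x) \<le> f (- x)" "sublinear_on sc V g"
          using that CA V_closed by (auto simp: A_def)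
        then show ?thesis
          using sublinear_neg[of g x] that by simp
      qed
      have u_le: "u x \<le> g x" if "g \<in> C" "x \<in> V" for g x
        unfolding u_def using that low
        by (auto intro!: cINF_lower bdd_belowI[where m = "- f (- x)"])
      have u_ge: "M \<le> u x" if "\<And>g. g \<in> C \<Longrightarrow> M \<le> g x" for M x
        unfolding u_def using False that by (auto intro!: cINF_greatest)
      have sub: "sublinear_on sc V g" if "g \<in> C" for g
        using that CA by (auto simp: A_def)
      have "sublinear_on sc V u"
        unfolding sublinear_on_def
      proof (intro conjI ballI allI impI)
        fix x y assume xy: "x \<in> V" "y \<in> V"
        have main: "u (x + y) \<le> g x + h y" if gh: "g \<in> C" "h \<in> C" for g h
        proof -
          obtain k where k: "k \<in> C" "k x \<le> g x" "k y \<le> h y"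
            using total[OF gh] gh by (auto simp: P_def)
          have "u (x + y) \<le> k (x + y)"
            using k xy V_closed by (intro u_le) auto
          also have "\<dots> \<le> k x + k y"
            using k xy by (intro sublinear_add[OF sub]) auto
          finally show ?thesis using k by simp
        qed
        have "u (x + y) - g x \<le> u y" if g: "g \<in> C" for g
        proof (rule u_ge)
          show "u (x + y) - g x \<le> h y" if "h \<in> C" for h
            using main[OF g that] by simp
        qed
        then have "u (x + y) - u y \<le> u x"
          by (intro u_ge) (simp add: algebra_simps)
        then show "u (x + y) \<le> u x + u y" by simp
      next
        fix x and r :: real assume x: "x \<in> V" and r: "r > 0"
        have "u (sc r x) / r \<le> u x"
        proof (rule u_ge)
          fix g assume g: "g \<in> C"
          have "u (sc r x) \<le> g (sc r x)"
            using g x V_closed by (intro u_le) auto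
          also have "\<dots> = r * g x"
            by (rule sublinear_scale[OF sub[OF g] x r])
          finally show "u (sc r x) / r \<le> g x"
            using r by (simp add: field_simps)
        qed
        then show "u (sc r x) \<le> r * u x"
          using r by (simp add: field_simps)
      qed
      moreover have "u x \<le> f x" if "x \<in> V" for x
      proof -
        obtain g where "g \<in> C" using False by blast
        then have "u x \<le> g x" "g x \<le> f x"
          using u_le that CA by (auto simp: A_def)
        then show ?thesis by simp
      qed
      ultimately have "(\<lambda>x. if x \<in> V then u x else 0) \<in> A"
        by (rule cut)
      moreover have "P a (\<lambda>x. if x \<in> V then u x else 0)" if "a \<in> C" for a
        using that CA u_le by (auto simp: P_def A_def)
      ultimately show ?thesis by blast
    qed
  qed
  then obtain m where mA: "m \<in> A" and min: "\<And>a. \<lbrakk>a \<in> A; P m a\<rbrakk> \<Longrightarrow> a = m"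
    by blast
  show thesis
  proof (rule that)
    show "sublinear_on sc V m" "\<And>x. x \<in> V \<Longrightarrow> m x \<le> f x"
      using mA by (auto simp: A_def)
    fix g assume g: "sublinear_on sc V g" "\<And>x. x \<in> V \<Longrightarrow> g x \<le> m x"
    have "(\<lambda>x. if x \<in> V then g x else 0) \<in> A"
      using g mA by (intro cut) (auto simp: A_def intro: order_trans)
    moreover have "P m (\<lambda>x. if x \<in> V then g x else 0)"
      using g mA by (auto simp: P_def A_def)
    ultimately have "(\<lambda>x. if x \<in> V then g x else 0) = m"
      by (rule min)
    from fun_cong[OF this] show "\<forall>x\<in>V. g x = m x"
      by presburger
  qed
qed

text \<open>
  A minimal sublinear functional \<open>m\<close> agrees with all its tilts, so \<open>m (- y) = - m y\<close>, and
  subadditivity becomes additivity. Minimizing below the tilt of \<open>f\<close> at \<open>z\<close> forces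
  \<open>m (- z) \<le> - f z\<close>, which prescribes the value at \<open>z\<close>.
\<close>

theorem real_Hahn_Banach:
  assumes f: "sublinear_on sc V f" and z: "z \<in> V"
  obtains l where "\<And>x y. \<lbrakk>x \<in> V; y \<in> V\<rbrakk> \<Longrightarrow> l (x + y) = l x + l y"
    "\<And>r x. x \<in> V \<Longrightarrow> l (sc r x) = r * l x"
    "\<And>x. x \<in> V \<Longrightarrow> l x \<le> f x" "l z = f z"
proof -
  obtain m where m: "sublinear_on sc V m" and le: "\<And>x. x \<in> V \<Longrightarrow> m x \<le> tilt f z x"
    and min: "\<And>g. \<lbrakk>sublinear_on sc V g; \<And>x. x \<in> V \<Longrightarrow> g x \<le> m x\<rbrakk> \<Longrightarrow> \<forall>x\<in>V. g x = m x"
    using minimal_sublinear_exists[OF sublinear_tilt[OF f z]] by blast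
  have neg: "m (- y) = - m y" if y: "y \<in> V" for y
  proof (rule antisym)
    have "m (- y) = tilt m y (- y)"
      using min[OF sublinear_tilt[OF m y] tilt_le_self[OF m y]] V_closed(4)[OF y] by simp
    then show "m (- y) \<le> - m y"
      using tilt_neg_le[OF m y] by simp
    show "- m y \<le> m (- y)"
      using sublinear_neg[OF m y] by simp
  qed
  show thesis
  proof (rule that)
    fix x y assume xy: "x \<in> V" "y \<in> V"
    have "m x = m ((x + y) + (- y))"
      by simp
    also have "\<dots> \<le> m (x + y) - m y"
      using sublinear_add[OF m, of "x + y" "- y"] xy V_closed neg[OF xy(2)] by simp
    finally show "m (x + y) = m x + m y"
      using sublinear_add[OF m xy] by simp
  next
    fix r :: real and x assume x: "x \<in> V"
    consider "r = 0" | "r > 0" | "r < 0" by linarith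
    then show "m (sc r x) = r * m x"
    proof cases
      case 3
      have "m (sc r x) = m (- sc (- r) x)"
        by simp
      also have "\<dots> = - (- r * m x)"
        using 3 x V_closed by (subst neg) (auto simp del: scale_minus_left simp: sublinear_scale[OF m x])
      finally show ?thesis by simp
    qed (use x sublinear_0[OF m] sublinear_scale[OF m x] in auto)
  next
    fix x assume "x \<in> V"
    then show "m x \<le> f x"
      using le tilt_le_self[OF f z] order_trans by blast
  next
    have "m (- z) \<le> - f z"
      using le[OF V_closed(4)[OF z]] tilt_neg_le[OF f z] by simp
    moreover have "m z \<le> f z"
      using le[OF z] tilt_le_self[OF f z z] by simp
    ultimately show "m z = f z"
      using neg[OF z] by simp
  qed
qed

end

text \<open>
  Over the complex numbers, a real functional \<open>l\<close> below a seminorm is the real part of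
  \<open>x \<mapsto> l x - i l (i x)\<close>, and rotating \<open>x\<close> until this value is a nonnegative real shows that the
  complex functional is bounded by the same seminorm.
\<close>

theorem seminorm_Hahn_Banach:
  fixes smul :: "'k::real_or_complex \<Rightarrow> 'v::ab_group_add \<Rightarrow> 'v" and s :: "'v \<Rightarrow> real"
  assumes vs: "vector_space smul" and V: "module.subspace smul V"
    and s_add: "\<And>x y. \<lbrakk>x \<in> V; y \<in> V\<rbrakk> \<Longrightarrow> s (x + y) \<le> s x + s y"
    and s_scale: "\<And>c x. x \<in> V \<Longrightarrow> s (smul c x) = norm c * s x"
    and z: "z \<in> V"
  obtains \<phi> :: "'v \<Rightarrow> 'k" where "\<And>x y. \<lbrakk>x \<in> V; y \<in> V\<rbrakk> \<Longrightarrow> \<phi> (x + y) = \<phi> x + \<phi> y"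
    "\<And>c x. x \<in> V \<Longrightarrow> \<phi> (smul c x) = c * \<phi> x"
    "\<And>x. x \<in> V \<Longrightarrow> norm (\<phi> x) \<le> s x" "norm (\<phi> z) = s z"
proof -
  interpret vector_space smul by (rule vs)
  define sc where "sc = (\<lambda>r. smul (of_real r))"
  interpret R: vector_space sc
    by standard (simp_all add: sc_def scale_right_distrib scale_left_distrib)
  interpret R: real_subspace sc V
    by standard (use V in \<open>unfold R.subspace_def, unfold subspace_def sc_def, blast\<close>)
  have Vs: "smul c x \<in> V" if "x \<in> V" for c x
    using V that by (rule subspace_scale)
  have "sublinear_on sc V s"
    by (auto simp: sublinear_on_def s_add sc_def s_scale)
  then obtain l where l_add: "\<And>x y. \<lbrakk>x \<in> V; y \<in> V\<rbrakk> \<Longrightarrow> l (x + y) = l x + l y"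
    and l_scale: "\<And>r x. x \<in> V \<Longrightarrow> l (sc r x) = r * l x"
    and l_le: "\<And>x. x \<in> V \<Longrightarrow> l x \<le> s x" and l_z: "l z = s z"
    using R.real_Hahn_Banach[OF _ z] by blast
  have l_abs: "\<bar>l x\<bar> \<le> s x" if "x \<in> V" for x
  proof -
    have "l (sc (- 1) x) \<le> s (sc (- 1) x)"
      using that R.V_closed by (intro l_le) auto
    then have "- l x \<le> s x"
      using that s_scale[of x "of_real (- 1)"] l_scale[of x "-1"] by (simp add: sc_def)
    then show ?thesis
      using l_le[OF that] by linarith
  qed
  show thesis
    using real_or_complex[where 'a = 'k]
  proof
    assume real: "\<forall>c::'k. \<exists>a. c = a *\<^sub>R 1"
    show thesis
    proof (rule that)
      show "(of_real (l (x + y)) :: 'k) = of_real (l x) + of_real (l y)" if "x \<in> V" "y \<in> V" for x y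
        using l_add[OF that] by simp
      show "of_real (l (smul c x)) = c * of_real (l x)" if x: "x \<in> V" for c x
      proof -
        obtain a where "c = of_real a"
          using real unfolding of_real_def by blast
        then show ?thesis
          using l_scale[OF x, of a] by (simp add: sc_def)
      qed
      show "norm (of_real (l x) :: 'k) \<le> s x" if "x \<in> V" for x
        using l_abs[OF that] by simp
      show "norm (of_real (l z) :: 'k) = s z"
        using l_abs[OF z] l_z by simp
    qed
  next
    assume "\<exists>i::'k. i * i = - 1 \<and>
        (\<forall>z. \<exists>a b. z = a *\<^sub>R 1 + b *\<^sub>R i \<and> norm z = sqrt (a\<^sup>2 + b\<^sup>2))"
    then obtain i :: 'k where i: "i * i = - 1"
        and rep: "\<forall>z. \<exists>a b. z = a *\<^sub>R 1 + b *\<^sub>R i \<and> norm z = sqrt (a\<^sup>2 + b\<^sup>2)"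
      by blast
    have norm_rep: "norm (of_real a + of_real b * i) = sqrt (a\<^sup>2 + b\<^sup>2)" for a b
      by (rule norm_real_plus_imaginary[OF i rep])
    define \<phi> where "\<phi> x = of_real (l x) - of_real (l (smul i x)) * i" for x
    have norm_\<phi>: "norm (\<phi> x) = sqrt ((l x)\<^sup>2 + (l (smul i x))\<^sup>2)" for x
      using norm_rep[of "l x" "- l (smul i x)"] by (simp add: \<phi>_def)
    have \<phi>_add: "\<phi> (x + y) = \<phi> x + \<phi> y" if "x \<in> V" "y \<in> V" for x y
      using that Vs by (simp add: \<phi>_def l_add scale_right_distrib algebra_simps)
    have l_real: "l (smul (of_real a) x) = a * l x" if "x \<in> V" for a x
      using l_scale[OF that] by (simp add: sc_def)
    have \<phi>_i: "\<phi> (smul i x) = i * \<phi> x" if x: "x \<in> V" for x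
    proof -
      have "l (smul i (smul i x)) = - l x"
        using l_real[OF x, of "- 1"] i by simp
      moreover have "i * (w * i) = - w" for w
        by (metis i mult.left_commute mult_minus1_right)
      ultimately show ?thesis
        by (simp add: \<phi>_def right_diff_distrib mult.commute[of i "of_real (l x)"])
    qed
    have \<phi>_real: "\<phi> (smul (of_real a) x) = of_real a * \<phi> x" if x: "x \<in> V" for a x
      using l_real[OF x] l_real[OF Vs[OF x], of a i]
      by (simp add: \<phi>_def algebra_simps scale_left_commute)
    have \<phi>_scale: "\<phi> (smul c x) = c * \<phi> x" if x: "x \<in> V" for c x
    proof -
      obtain a b where c: "c = of_real a + of_real b * i"
        using rep[rule_format, of c] by (auto simp: scaleR_conv_of_real)
      have "smul c x = smul (of_real a) x + smul (of_real b) (smul i x)"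
        by (simp add: c scale_left_distrib)
      then show ?thesis
        using x Vs by (simp add: \<phi>_add \<phi>_real \<phi>_i c algebra_simps del: scale_scale)
    qed
    have \<phi>_le: "norm (\<phi> x) \<le> s x" if x: "x \<in> V" for x
    proof (cases "\<phi> x = 0")
      case True
      then show ?thesis using l_abs[OF x] by simp
    next
      case False
      \<comment> \<open>\<open>u\<close> rotates \<open>\<phi> x\<close> onto the positive real axis, where \<open>\<phi>\<close> and \<open>l\<close> agree.\<close>
      define u where "u = of_real (norm (\<phi> x)) / \<phi> x"
      define w where "w = smul u x"
      have w: "w \<in> V"
        using x Vs by (simp add: w_def)
      have nu: "norm u = 1" and \<phi>_w: "\<phi> w = of_real (norm (\<phi> x))"
        using False x by (simp_all add: u_def w_def norm_divide \<phi>_scale)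
      have "of_real (l w - norm (\<phi> x)) + of_real (- l (smul i w)) * i = \<phi> w - of_real (norm (\<phi> x))"
        by (simp add: \<phi>_def[of w])
      then have "sqrt ((l w - norm (\<phi> x))\<^sup>2 + (- l (smul i w))\<^sup>2) = 0"
        unfolding \<phi>_w by (metis norm_rep norm_zero diff_self)
      then have "norm (\<phi> x) = l w"
        by simp
      also have "\<dots> \<le> s w"
        using w by (rule l_le)
      finally show ?thesis
        using s_scale[OF x] nu by (simp add: w_def)
    qed
    have "norm (\<phi> z) \<ge> \<bar>l z\<bar>"
      unfolding norm_\<phi> by (rule real_le_rsqrt) simp
    then have "norm (\<phi> z) = s z"
      using \<phi>_le[OF z] l_z by linarith
    then show thesis
      using that \<phi>_add \<phi>_scale \<phi>_le by blast
  qed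
qed

section \<open>Uniform boundedness\<close>

text \<open>
  Suppose that the set is unbounded in \<open>\<ell>\<^sub>p\<close>. Choose \<open>b k\<close> in it and \<open>N k\<close> such that the norm of
  \<open>b k\<close> on the first \<open>N k\<close> coordinates exceeds \<open>k * 3 ^ (k + 1)\<close> and is maximal up to the factor
  \<open>3 / 2\<close>. Signs can be chosen such that each partial sum of the series of the
  \<open>\<plusminus> b k / 3 ^ (k + 1)\<close> is, on the first \<open>N k\<close> coordinates, at least as large as its last term, since
  \<open>u + v\<close> and \<open>u - v\<close> cannot both have smaller norm than \<open>v\<close>. The tail after this term is
  \<open>1 / (2 * 3 ^ (k + 1))\<close> times a member of the set, so its norm is at most three quarters of
  that of the term. The limit therefore has norm at least \<open>k / 4\<close> for every \<open>k\<close>, although it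
  is a member of the set.
\<close>

theorem bounded_if_countably_absolutely_convex:
  fixes K :: "(nat \<Rightarrow> 'k::real_or_complex) set"
  assumes p: "p \<ge> 1" and summ: "\<And>a. a \<in> K \<Longrightarrow> lp_summable p a"
    and coord: "\<And>n. \<exists>M. \<forall>a\<in>K. norm (a n) \<le> M"
    and comb: "\<And>b c. \<lbrakk>\<And>j. b j \<in> K; summable (\<lambda>j. \<bar>c j\<bar>); (\<Sum>j. \<bar>c j\<bar>) \<le> 1\<rbrakk> \<Longrightarrow>
      (\<lambda>n. \<Sum>j. of_real (c j) * b j n) \<in> K"
  shows "\<exists>M. \<forall>a\<in>K. lp_norm p a \<le> M"
proof (rule ccontr)
  assume "\<not> ?thesis"
  then have unbounded: "\<exists>a\<in>K. M < lp_norm p a" for M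
    by (meson not_le)
  have p0: "p > 0" using p by simp
  define s where "s N a = lp_norm p (trunc N a)" for N and a :: "nat \<Rightarrow> 'k"
  have s_add: "s N (\<lambda>n. a n + b n) \<le> s N a + s N b" for N a b
  proof -
    have "trunc N (\<lambda>n. a n + b n) = (\<lambda>n. trunc N a n + trunc N b n)"
      by (auto simp: trunc_def)
    then show ?thesis
      using lp_add(2)[OF p, of "trunc N a" "trunc N b"] by (simp add: s_def)
  qed
  have s_scale: "s N (\<lambda>n. of_real r * a n) = \<bar>r\<bar> * s N a" for N r a
    unfolding s_def by (rule lp_scale(2)[OF p0 _ _ lp_summable_trunc]) (auto simp: trunc_def norm_mult)
  obtain M where M: "\<And>n a. a \<in> K \<Longrightarrow> norm (a n) \<le> M n"
    using coord by metis
  have s_bound: "s N a \<le> lp_norm p (trunc N M)" if "a \<in> K" for N a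
    unfolding s_def
    by (rule lp_mono(2)[OF p0 lp_summable_trunc])
      (use M[OF that] in \<open>auto simp: trunc_def intro: order_trans[OF _ abs_ge_self]\<close>)
  \<comment> \<open>The supremum of \<open>s N\<close> over \<open>K\<close> is finite for each \<open>N\<close>, so it is attained up to a factor.\<close>
  have "\<exists>N b. b \<in> K \<and> m < s N b \<and> (\<forall>a\<in>K. s N a \<le> 3 / 2 * s N b)" if m: "m \<ge> 0" for m
  proof -
    obtain a where a: "a \<in> K" "m < lp_norm p a"
      using unbounded by blast
    obtain N where N: "m < s N a"
    proof (rule ccontr)
      assume "\<not> thesis"
      then have "lp_norm p (trunc N a) \<le> m" for N
        using that by (force simp: s_def not_le[symmetric])
      then show False
        using lp_norm_le_if_trunc_le(2)[OF p0] a(2) by (meson not_le)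
    qed
    define S where "S = (SUP b\<in>K. s N b)"
    have S: "s N b \<le> S" if "b \<in> K" for b
      unfolding S_def using that s_bound by (auto intro!: cSUP_upper bdd_aboveI)
    then have "max m (2 / 3 * S) < S"
      using N a m by force
    then obtain b where b: "b \<in> K" "max m (2 / 3 * S) < s N b"
      unfolding S_def using a(1) less_cSUP_iff[of K "s N"] s_bound
      by (metis (no_types, lifting) bdd_aboveI2 empty_iff)
    have "s N a' \<le> 3 / 2 * s N b" if "a' \<in> K" for a'
      using S[OF that] b(2) by simp
    then show ?thesis
      using b by auto
  qed
  then have "\<forall>k. \<exists>N b. b \<in> K \<and> real k * 3 ^ Suc k < s N b \<and> (\<forall>a\<in>K. s N a \<le> 3 / 2 * s N b)"
    by simp
  then obtain N b where b: "\<And>k. b k \<in> K" and big: "\<And>k. real k * 3 ^ Suc k < s (N k) (b k)"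
    and near_max: "\<And>k a. a \<in> K \<Longrightarrow> s (N k) a \<le> 3 / 2 * s (N k) (b k)"
    by metis
  define \<delta> where "\<delta> k u = (if s (N k) (\<lambda>n. u n - of_real (1 / 3 ^ Suc k) * b k n)
      \<le> s (N k) (\<lambda>n. u n + of_real (1 / 3 ^ Suc k) * b k n) then 1 else - 1) / (3::real) ^ Suc k" for k u
  define \<psi> where "\<psi> = rec_nat (\<lambda>n. 0) (\<lambda>k u n. u n + of_real (\<delta> k u) * b k n)"
  define c where "c k = \<delta> k (\<psi> k)" for k
  have abs_c: "\<bar>c k\<bar> = 1 / 3 ^ Suc k" for k
    by (simp add: c_def \<delta>_def)
  have \<psi>_Suc: "\<psi> (Suc k) = (\<lambda>n. \<psi> k n + of_real (c k) * b k n)" for k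
    by (simp add: \<psi>_def c_def)
  have \<psi>_sum: "\<psi> k n = (\<Sum>j<k. of_real (c j) * b j n)" for k n
    by (induction k) (simp_all add: \<psi>_Suc, simp add: \<psi>_def)
  have \<psi>_large: "s (N k) (b k) / 3 ^ Suc k \<le> s (N k) (\<psi> (Suc k))" for k
  proof -
    define r :: real where "r = 1 / 3 ^ Suc k"
    define A B where "A = (\<lambda>n. \<psi> k n + of_real r * b k n)" and "B = (\<lambda>n. \<psi> k n - of_real r * b k n)"
    have "(\<lambda>n. of_real (2 * r) * b k n) = (\<lambda>n. A n + of_real (- 1) * B n)"
      by (auto simp: A_def B_def algebra_simps)
    then have "2 * r * s (N k) (b k) = s (N k) (\<lambda>n. A n + of_real (- 1) * B n)"
      using s_scale[of "N k" "2 * r" "b k"] by (simp add: r_def)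
    also have "\<dots> \<le> s (N k) A + s (N k) B"
      using s_add[of "N k" A "\<lambda>n. of_real (- 1) * B n"] s_scale[of "N k" "-1" B] by simp
    also have "\<dots> \<le> 2 * s (N k) (\<psi> (Suc k))"
    proof (cases "s (N k) B \<le> s (N k) A")
      case True
      then have "\<psi> (Suc k) = A"
        unfolding \<psi>_Suc by (simp add: c_def \<delta>_def A_def B_def r_def)
      then show ?thesis using True by simp
    next
      case False
      then have "\<psi> (Suc k) = B"
        unfolding \<psi>_Suc by (simp add: c_def \<delta>_def A_def B_def r_def)
      then show ?thesis using False by simp
    qed
    finally show ?thesis by (simp add: r_def)
  qed
  have geo: "(\<lambda>j. 1 / 3 ^ Suc j :: real) sums (1 / 2)"
    using sums_mult[OF geometric_sums[of "1 / 3 :: real"], of "1 / 3"]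
    by (simp add: power_one_over)
  have geo2: "(\<lambda>j. 2 * (1 / 3 ^ Suc j) :: real) sums 1"
    using sums_mult[OF geo, of 2] by simp
  define \<Psi> where "\<Psi> n = (\<Sum>j. of_real (c j) * b j n)" for n
  have "\<Psi> \<in> K"
    unfolding \<Psi>_def using geo by (intro comb b) (simp_all add: abs_c sums_iff)
  have \<Psi>_large: "real k / 4 \<le> lp_norm p \<Psi>" for k
  proof -
    define d where "d j = 2 * 3 ^ Suc k * c (j + Suc k)" for j
    define \<tau> where "\<tau> n = (\<Sum>j. of_real (d j) * b (j + Suc k) n)" for n
    have abs_d: "\<bar>d j\<bar> = 2 * (1 / 3 ^ Suc j)" for j
      by (simp add: d_def abs_mult abs_c power_add)
    have "\<tau> \<in> K"
      unfolding \<tau>_def using geo2 by (intro comb b) (simp_all only: abs_d sums_iff)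
    \<comment> \<open>The factor in \<open>d\<close> normalizes the tail to a combination with coefficient sum \<open>1\<close>.\<close>
    have split: "\<psi> (Suc k) n = \<Psi> n + of_real (- 1 / (2 * 3 ^ Suc k)) * \<tau> n" for n
    proof -
      have norm_le: "norm (of_real (c j) * b j n) \<le> 1 / 3 ^ Suc j * M n" for j
        unfolding norm_mult using M[OF b, of j n] by (auto simp: abs_c intro!: mult_left_mono divide_right_mono)
      have "summable (\<lambda>j. norm (of_real (c j) * b j n))"
      proof (rule summable_comparison_test')
        show "summable (\<lambda>j. 1 / 3 ^ Suc j * M n)"
          by (rule summable_mult2[OF sums_summable[OF geo]])
        show "norm (norm (of_real (c j) * b j n)) \<le> 1 / 3 ^ Suc j * M n" if "j \<ge> 0" for j
          using norm_le[of j] by (simp only: real_norm_def abs_norm_cancel)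
      qed
      then have sm: "summable (\<lambda>j. of_real (c j) * b j n)"
        by (rule summable_scalar_norm_cancel)
      have "\<tau> n = (\<Sum>j. of_real (2 * 3 ^ Suc k) * (of_real (c (j + Suc k)) * b (j + Suc k) n))"
        by (simp add: \<tau>_def d_def mult.assoc)
      also have "\<dots> = of_real (2 * 3 ^ Suc k) * (\<Sum>j. of_real (c (j + Suc k)) * b (j + Suc k) n)"
        using summable_ignore_initial_segment[OF sm, of "Suc k"] by (rule suminf_mult)
      finally have "(\<Sum>j. of_real (c (j + Suc k)) * b (j + Suc k) n) = of_real (1 / (2 * 3 ^ Suc k)) * \<tau> n"
        by simp
      then show ?thesis
        using suminf_split_initial_segment[OF sm, of "Suc k"]
        unfolding \<Psi>_def \<psi>_sum by simp
    qed
    have "s (N k) (b k) / 3 ^ Suc k \<le> s (N k) (\<psi> (Suc k))"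
      by (rule \<psi>_large)
    also have "\<dots> \<le> s (N k) \<Psi> + 1 / (2 * 3 ^ Suc k) * s (N k) \<tau>"
      using s_add[of "N k" \<Psi> "\<lambda>n. of_real (- 1 / (2 * 3 ^ Suc k)) * \<tau> n"]
        s_scale[of "N k" "- 1 / (2 * 3 ^ Suc k)" \<tau>]
      unfolding split[abs_def, symmetric] by (simp add: split)
    also have "\<dots> \<le> lp_norm p \<Psi> + 1 / (2 * 3 ^ Suc k) * (3 / 2 * s (N k) (b k))"
      using near_max[OF \<open>\<tau> \<in> K\<close>, of k] lp_norm_trunc_le[OF p0 summ[OF \<open>\<Psi> \<in> K\<close>], of "N k"]
      by (intro add_mono mult_left_mono) (simp_all add: s_def)
    finally have "s (N k) (b k) / 3 ^ Suc k / 4 \<le> lp_norm p \<Psi>"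
      by simp
    moreover have "real k < s (N k) (b k) / 3 ^ Suc k"
      using big[of k] by (simp add: field_simps)
    ultimately show ?thesis by simp
  qed
  obtain k :: nat where "4 * lp_norm p \<Psi> < real k"
    using reals_Archimedean2 by blast
  then show False
    using \<Psi>_large[of k] by simp
qed

section \<open>Topologies given by directed families of seminorms\<close>

locale directed_seminorms =
  fixes V :: "'v::ab_group_add set" and P :: "('v \<Rightarrow> real) set"
  assumes diff_closed: "\<lbrakk>x \<in> V; y \<in> V\<rbrakk> \<Longrightarrow> x - y \<in> V"
    and zero: "\<rho> \<in> P \<Longrightarrow> \<rho> 0 = 0"
    and triangle: "\<lbrakk>\<rho> \<in> P; x \<in> V; y \<in> V\<rbrakk> \<Longrightarrow> \<rho> (x + y) \<le> \<rho> x + \<rho> y"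
    and nonempty: "P \<noteq> {}"
    and directed: "\<lbrakk>\<rho> \<in> P; \<sigma> \<in> P\<rbrakk> \<Longrightarrow> \<exists>\<tau>\<in>P. \<forall>x\<in>V. \<rho> x \<le> \<tau> x \<and> \<sigma> x \<le> \<tau> x"
begin

lemma ball_in_ball:
  assumes "\<rho> \<in> P" "x \<in> V" "y \<in> V" "z \<in> V" "\<rho> (z - y) < \<epsilon> - \<rho> (y - x)"
  shows "\<rho> (z - x) < \<epsilon>"
  using triangle[of \<rho> "z - y" "y - x"] assms diff_closed by simp

text \<open>
  Directedness turns finite intersections of balls into balls of a single seminorm.
\<close>

lemma openin_seminorm_topology_iff:
  "openin (seminorm_topology V P) A \<longleftrightarrow>
    A \<subseteq> V \<and> (\<forall>x\<in>A. \<exists>\<rho>\<in>P. \<exists>\<epsilon>>0. \<forall>y\<in>V. \<rho> (y - x) < \<epsilon> \<longrightarrow> y \<in> A)"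
proof
  assume A: "openin (seminorm_topology V P) A"
  have "\<forall>x\<in>A \<inter> V. \<exists>\<rho>\<in>P. \<exists>\<epsilon>>0. \<forall>y\<in>V. \<rho> (y - x) < \<epsilon> \<longrightarrow> y \<in> A"
    using openin_topology_generated_by[OF A[unfolded seminorm_topology_def]]
  proof (induction rule: generate_topology_on.induct)
    case Empty
    then show ?case by simp
  next
    case (Int A B)
    show ?case
    proof
      fix x assume x: "x \<in> A \<inter> B \<inter> V"
      obtain \<rho> \<epsilon> where \<rho>: "\<rho> \<in> P" "\<epsilon> > 0" "\<forall>y\<in>V. \<rho> (y - x) < \<epsilon> \<longrightarrow> y \<in> A"
        using Int.IH(1) x by blast
      obtain \<sigma> \<delta> where \<sigma>: "\<sigma> \<in> P" "\<delta> > 0" "\<forall>y\<in>V. \<sigma> (y - x) < \<delta> \<longrightarrow> y \<in> B"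
        using Int.IH(2) x by blast
      obtain \<tau> where \<tau>: "\<tau> \<in> P" "\<forall>x\<in>V. \<rho> x \<le> \<tau> x \<and> \<sigma> x \<le> \<tau> x"
        using directed[OF \<rho>(1) \<sigma>(1)] by blast
      have "y \<in> A \<inter> B" if y: "y \<in> V" "\<tau> (y - x) < min \<epsilon> \<delta>" for y
      proof -
        have "\<rho> (y - x) \<le> \<tau> (y - x)" "\<sigma> (y - x) \<le> \<tau> (y - x)"
          using \<tau>(2) diff_closed y(1) x by auto
        then show ?thesis
          using \<rho>(3) \<sigma>(3) y by auto
      qed
      then show "\<exists>\<rho>\<in>P. \<exists>\<epsilon>>0. \<forall>y\<in>V. \<rho> (y - x) < \<epsilon> \<longrightarrow> y \<in> A \<inter> B"
        using \<tau>(1) \<rho>(2) \<sigma>(2) by (intro bexI[of _ \<tau>] exI[of _ "min \<epsilon> \<delta>"]) auto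
    qed
  next
    case (UN K)
    show ?case
    proof
      fix x assume "x \<in> \<Union>K \<inter> V"
      then obtain B where B: "B \<in> K" "x \<in> B \<inter> V" by blast
      then obtain \<rho> \<epsilon> where "\<rho> \<in> P" "\<epsilon> > 0" "\<forall>y\<in>V. \<rho> (y - x) < \<epsilon> \<longrightarrow> y \<in> B"
        using UN.IH[OF B(1)] by blast
      then show "\<exists>\<rho>\<in>P. \<exists>\<epsilon>>0. \<forall>y\<in>V. \<rho> (y - x) < \<epsilon> \<longrightarrow> y \<in> \<Union>K"
        using B(1) by blast
    qed
  next
    case (Basis B)
    show ?case
    proof
      fix x assume x: "x \<in> B \<inter> V"
      consider "B = V" | w \<rho> \<epsilon> where "B = {y \<in> V. \<rho> (y - w) < \<epsilon>}" "w \<in> V" "\<rho> \<in> P"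
        using Basis by blast
      then show "\<exists>\<rho>\<in>P. \<exists>\<epsilon>>0. \<forall>y\<in>V. \<rho> (y - x) < \<epsilon> \<longrightarrow> y \<in> B"
      proof cases
        case 1
        then show ?thesis using nonempty by (auto intro: exI[of _ 1])
      next
        case 2
        then show ?thesis
          using x ball_in_ball[of \<rho> w x]
          by (intro bexI[of _ \<rho>] exI[of _ "\<epsilon> - \<rho> (x - w)"]) auto
      qed
    qed
  qed
  then show "A \<subseteq> V \<and> (\<forall>x\<in>A. \<exists>\<rho>\<in>P. \<exists>\<epsilon>>0. \<forall>y\<in>V. \<rho> (y - x) < \<epsilon> \<longrightarrow> y \<in> A)"
    using openin_subset[OF A] by (simp add: Int_absorb2)
next
  assume A: "A \<subseteq> V \<and> (\<forall>x\<in>A. \<exists>\<rho>\<in>P. \<exists>\<epsilon>>0. \<forall>y\<in>V. \<rho> (y - x) < \<epsilon> \<longrightarrow> y \<in> A)"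
  have "\<exists>B. openin (seminorm_topology V P) B \<and> x \<in> B \<and> B \<subseteq> A" if x: "x \<in> A" for x
  proof -
    obtain \<rho> \<epsilon> where \<rho>: "\<rho> \<in> P" "\<epsilon> > 0" "\<forall>y\<in>V. \<rho> (y - x) < \<epsilon> \<longrightarrow> y \<in> A"
      using A x by blast
    have "openin (seminorm_topology V P) {y \<in> V. \<rho> (y - x) < \<epsilon>}"
      unfolding seminorm_topology_def using \<rho> x A by (intro topology_generated_by_Basis) blast
    then show ?thesis
      using \<rho> x A zero[OF \<rho>(1)] by (intro exI[of _ "{y \<in> V. \<rho> (y - x) < \<epsilon>}"]) auto
  qed
  then show "openin (seminorm_topology V P) A"
    by (rule openin_subopen[THEN iffD2, rule_format])
qed

end

text \<open>
  For an additive map, continuity at zero suffices.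
\<close>

lemma continuous_map_seminorm_topology_iff:
  assumes P: "directed_seminorms V P" and Q: "directed_seminorms W Q"
    and f_diff: "\<And>x y. \<lbrakk>x \<in> V; y \<in> V\<rbrakk> \<Longrightarrow> f (x - y) = f x - f y"
  shows "continuous_map (seminorm_topology V P) (seminorm_topology W Q) f \<longleftrightarrow>
    (\<forall>x\<in>V. f x \<in> W) \<and> (\<forall>\<sigma>\<in>Q. \<forall>\<epsilon>>0. \<exists>\<rho>\<in>P. \<exists>\<delta>>0. \<forall>y\<in>V. \<rho> y < \<delta> \<longrightarrow> \<sigma> (f y) < \<epsilon>)"
    (is "?cont \<longleftrightarrow> ?into \<and> ?bound")
proof
  interpret P: directed_seminorms V P by (rule P)
  interpret Q: directed_seminorms W Q by (rule Q)
  assume cont: ?cont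
  then have into: ?into
    by (auto simp: continuous_map_def)
  have ?bound
  proof (intro ballI allI impI)
    fix \<sigma> and \<epsilon> :: real assume \<sigma>: "\<sigma> \<in> Q" "\<epsilon> > 0"
    show "\<exists>\<rho>\<in>P. \<exists>\<delta>>0. \<forall>y\<in>V. \<rho> y < \<delta> \<longrightarrow> \<sigma> (f y) < \<epsilon>"
    proof (cases "V = {}")
      case True
      then show ?thesis using P.nonempty by (auto intro: exI[of _ 1])
    next
      case False
      then have V0: "0 \<in> V"
        using P.diff_closed by fastforce
      then have f0: "f 0 = 0"
        using f_diff[of 0 0] by simp
      then have W0: "0 \<in> W" using into V0 by force
      define S where "S = {x \<in> V. f x \<in> {w \<in> W. \<sigma> (w - 0) < \<epsilon>}}"
      have "openin (seminorm_topology W Q) {w \<in> W. \<sigma> (w - 0) < \<epsilon>}"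
        unfolding seminorm_topology_def using \<sigma> W0 by (intro topology_generated_by_Basis) blast
      from openin_continuous_map_preimage[OF cont this]
      have "openin (seminorm_topology V P) S"
        by (simp add: S_def)
      moreover have "0 \<in> S"
        using V0 W0 f0 \<sigma>(2) Q.zero[OF \<sigma>(1)] by (simp add: S_def)
      ultimately obtain \<rho> \<delta> where "\<rho> \<in> P" "\<delta> > 0" "\<forall>y\<in>V. \<rho> (y - 0) < \<delta> \<longrightarrow> y \<in> S"
        unfolding P.openin_seminorm_topology_iff by blast
      then show ?thesis
        by (intro bexI[of _ \<rho>] exI[of _ \<delta>]) (auto simp: S_def)
    qed
  qed
  with into show "?into \<and> ?bound" ..
next
  interpret P: directed_seminorms V P by (rule P)
  interpret Q: directed_seminorms W Q by (rule Q)
  assume ib: "?into \<and> ?bound"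
  show ?cont
    unfolding continuous_map_def
  proof (intro conjI allI impI)
    show "f \<in> topspace (seminorm_topology V P) \<rightarrow> topspace (seminorm_topology W Q)"
      using ib by auto
    fix B assume B: "openin (seminorm_topology W Q) B"
    show "openin (seminorm_topology V P) {x \<in> topspace (seminorm_topology V P). f x \<in> B}"
      unfolding P.openin_seminorm_topology_iff topspace_seminorm_topology
    proof (intro conjI ballI)
      fix x assume x: "x \<in> {x \<in> V. f x \<in> B}"
      then obtain \<sigma> \<epsilon> where \<sigma>: "\<sigma> \<in> Q" "\<epsilon> > 0" "\<forall>w\<in>W. \<sigma> (w - f x) < \<epsilon> \<longrightarrow> w \<in> B"
        using B unfolding Q.openin_seminorm_topology_iff by blast
      then obtain \<rho> \<delta> where \<rho>: "\<rho> \<in> P" "\<delta> > 0" "\<forall>y\<in>V. \<rho> y < \<delta> \<longrightarrow> \<sigma> (f y) < \<epsilon>"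
        using ib by blast
      have "f y \<in> B" if y: "y \<in> V" "\<rho> (y - x) < \<delta>" for y
      proof -
        have "\<sigma> (f (y - x)) < \<epsilon>"
          using \<rho>(3) y x P.diff_closed by simp
        then show ?thesis
          using \<sigma>(3) y x ib f_diff by simp
      qed
      then show "\<exists>\<rho>\<in>P. \<exists>\<epsilon>>0. \<forall>y\<in>V. \<rho> (y - x) < \<epsilon> \<longrightarrow> y \<in> {x \<in> V. f x \<in> B}"
        using \<rho> by blast
    qed auto
  qed
qed

lemma directed_seminorms_norm: "directed_seminorms (UNIV :: 'a::real_normed_vector set) {norm}"
  by standard (auto intro: norm_triangle_ineq)

text \<open>
  This makes the continuity criterion available for scalar functionals.
\<close>

lemma euclidean_eq_seminorm_topology:
  "(euclidean :: 'a::real_normed_vector topology) = seminorm_topology UNIV {norm}"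
proof -
  interpret directed_seminorms "UNIV :: 'a set" "{norm}" by (rule directed_seminorms_norm)
  show ?thesis
    unfolding topology_eq openin_seminorm_topology_iff by (auto simp: open_dist dist_norm)
qed

lemma directed_seminorms_strong_norm:
  assumes "q \<ge> 1"
  shows "directed_seminorms (strongly_summable_seqs q) {strong_norm q :: (nat \<Rightarrow> 'l::banach) \<Rightarrow> real}"
proof -
  have eq: "strong_norm q = (lp_norm q :: (nat \<Rightarrow> 'l) \<Rightarrow> real)"
    by (simp add: strong_norm_def lp_norm_def fun_eq_iff)
  show ?thesis
  proof
    fix x y :: "nat \<Rightarrow> 'l"
    assume xy: "x \<in> strongly_summable_seqs q" "y \<in> strongly_summable_seqs q"
    then show "x - y \<in> strongly_summable_seqs q"
      using lp_diff(1)[OF assms, of x y] by (simp add: strongly_summable_seqs_def fun_diff_def)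
    show "\<rho> (x + y) \<le> \<rho> x + \<rho> y" if "\<rho> \<in> {strong_norm q}" for \<rho>
      using lp_add(2)[OF assms, of x y] xy that
      by (simp add: eq strongly_summable_seqs_def plus_fun_def)
  qed (auto simp: strong_norm_def)
qed

section \<open>Neighborhoods of zero and their polars\<close>

context locally_convex_space
begin

lemma carrier_closed:
  shows "0 \<in> topspace X" "\<lbrakk>x \<in> topspace X; y \<in> topspace X\<rbrakk> \<Longrightarrow> x + y \<in> topspace X"
    "x \<in> topspace X \<Longrightarrow> smul c x \<in> topspace X" "x \<in> topspace X \<Longrightarrow> - x \<in> topspace X"
    "\<lbrakk>x \<in> topspace X; y \<in> topspace X\<rbrakk> \<Longrightarrow> x - y \<in> topspace X"
  using subspace_topspace
  by (simp_all add: subspace_0 subspace_add subspace_scale subspace_neg subspace_diff)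

lemma continuous_translation:
  assumes "a \<in> topspace X"
  shows "continuous_map X X (\<lambda>x. x + a)"
proof -
  have "continuous_map X (prod_topology X X) (\<lambda>x. (x, a))"
    using assms by (intro continuous_map_pairedI) auto
  from continuous_map_compose[OF this continuous_add] show ?thesis
    by (simp add: o_def)
qed

lemma continuous_scaling: "continuous_map X X (smul c)"
proof -
  have "continuous_map X (prod_topology euclidean X) (\<lambda>x. (c, x))"
    by (intro continuous_map_pairedI) auto
  from continuous_map_compose[OF this continuous_smul] show ?thesis
    by (simp add: o_def)
qed

lemma nhds_0_subset: "U \<in> closed_ac_nhds_0 smul X \<Longrightarrow> U \<subseteq> topspace X"
  by (auto simp: closed_ac_nhds_0_def dest: closedin_subset)

lemma absolutely_convex_balanced:
  assumes "absolutely_convex smul U" "x \<in> U" "norm c \<le> 1"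
  shows "smul c x \<in> U"
  using assms(1)[unfolded absolutely_convex_def, rule_format, OF assms(2,2), of c 0] assms(3) by simp

lemma nhds_0_absorbing:
  assumes U: "U \<in> closed_ac_nhds_0 smul X" and x: "x \<in> topspace X"
  obtains t :: real where "t > 0" "smul (of_real t) x \<in> U"
proof -
  obtain W where W: "openin X W" "0 \<in> W" "W \<subseteq> U"
    using U by (auto simp: closed_ac_nhds_0_def)
  have "continuous_map euclidean (prod_topology euclidean X) (\<lambda>c. (c, x))"
    using x by (intro continuous_map_pairedI) auto
  from continuous_map_compose[OF this continuous_smul]
  have "continuous_map euclidean X (\<lambda>c. smul c x)"
    by (simp add: o_def)
  from openin_continuous_map_preimage[OF this W(1)]
  have "open {c. smul c x \<in> W}" by simp
  then obtain e where e: "e > 0" "\<And>c. norm c < e \<Longrightarrow> smul c x \<in> W"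
    using W(2) open_dist[THEN iffD1, rule_format, of "{c. smul c x \<in> W}" 0] by (auto simp: dist_norm)
  then show thesis
    using that[of "e / 2"] e(2)[of "of_real (e / 2)"] W(3) by force
qed

lemma topspace_in_nhds_0: "topspace X \<in> closed_ac_nhds_0 smul X"
  using carrier_closed by (auto simp: closed_ac_nhds_0_def absolutely_convex_def)

lemma Int_in_nhds_0:
  assumes "U \<in> closed_ac_nhds_0 smul X" "W \<in> closed_ac_nhds_0 smul X"
  shows "U \<inter> W \<in> closed_ac_nhds_0 smul X"
proof -
  obtain A B where "openin X A" "0 \<in> A" "A \<subseteq> U" "openin X B" "0 \<in> B" "B \<subseteq> W"
    using assms by (auto simp: closed_ac_nhds_0_def)
  then have "openin X (A \<inter> B)" "0 \<in> A \<inter> B" "A \<inter> B \<subseteq> U \<inter> W"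
    by auto
  then show ?thesis
    using assms unfolding closed_ac_nhds_0_def absolutely_convex_def by blast
qed

lemma dual_add: "\<lbrakk>\<phi> \<in> dual smul X; x \<in> topspace X; y \<in> topspace X\<rbrakk> \<Longrightarrow> \<phi> (x + y) = \<phi> x + \<phi> y"
  and dual_scale: "\<lbrakk>\<phi> \<in> dual smul X; x \<in> topspace X\<rbrakk> \<Longrightarrow> \<phi> (smul c x) = c * \<phi> x"
  by (auto simp: dual_def is_operator_def)

lemma dual_0: "\<phi> \<in> dual smul X \<Longrightarrow> \<phi> 0 = 0"
  using dual_scale[of \<phi> 0 0] carrier_closed(1) by simp

text \<open>
  A linear functional that is bounded on a neighborhood of zero is continuous.
\<close>

lemma linear_in_polarI:
  assumes U: "U \<in> closed_ac_nhds_0 smul X"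
    and add: "\<And>x y. \<lbrakk>x \<in> topspace X; y \<in> topspace X\<rbrakk> \<Longrightarrow> \<phi> (x + y) = \<phi> x + \<phi> y"
    and scale: "\<And>c x. x \<in> topspace X \<Longrightarrow> \<phi> (smul c x) = c * \<phi> x"
    and le: "\<And>x. x \<in> U \<Longrightarrow> norm (\<phi> x) \<le> 1"
  shows "\<phi> \<in> polar smul X U"
proof -
  obtain W where W: "openin X W" "0 \<in> W" "W \<subseteq> U"
    using U by (auto simp: closed_ac_nhds_0_def)
  have "continuous_map X euclidean \<phi>"
    unfolding continuous_map_def
  proof (intro conjI allI impI)
    fix B :: "'k set" assume B: "openin euclidean B"
    show "openin X {x \<in> topspace X. \<phi> x \<in> B}"
    proof (subst openin_subopen, intro ballI)
      fix x assume x: "x \<in> {x \<in> topspace X. \<phi> x \<in> B}"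
      then obtain e where e: "e > 0" "\<And>w. norm (w - \<phi> x) < e \<Longrightarrow> w \<in> B"
        using B unfolding open_openin[symmetric] open_dist by (force simp: dist_norm)
      \<comment> \<open>Scaling by \<open>2 / e\<close> turns the bound \<open>1\<close> on \<open>U\<close> into the bound \<open>e / 2 < e\<close>.\<close>
      define c :: 'k where "c = of_real (2 / e)"
      define G where "G = {y \<in> topspace X. smul c (y + (- x)) \<in> W}"
      have "openin X G"
        unfolding G_def
        using continuous_map_compose[OF continuous_translation[of "- x"] continuous_scaling[of c]]
          x W(1) carrier_closed(4)
        by (intro openin_continuous_map_preimage[where Y = X]) (auto simp: o_def)
      moreover have "x \<in> G"
        using x W by (simp add: G_def)
      moreover have "G \<subseteq> {x \<in> topspace X. \<phi> x \<in> B}"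
      proof
        fix y assume y: "y \<in> G"
        then have y': "y \<in> topspace X" by (simp add: G_def)
        have "\<phi> (smul (- 1) x) = - \<phi> x"
          using x scale[of x "- 1"] by simp
        then have neg: "\<phi> (- x) = - \<phi> x" by simp
        have "\<phi> (smul c (y + (- x))) = c * \<phi> (y + (- x))"
          using x y' carrier_closed by (intro scale) auto
        also have "\<phi> (y + (- x)) = \<phi> y - \<phi> x"
          using x y' carrier_closed(4) by (subst add) (auto simp: neg)
        finally have "\<phi> (smul c (y + (- x))) = c * (\<phi> y - \<phi> x)" .
        then have "norm (c * (\<phi> y - \<phi> x)) \<le> 1"
          using le[of "smul c (y + (- x))"] y W(3) by (auto simp: G_def)
        then have "2 / e * norm (\<phi> y - \<phi> x) \<le> 1"
          unfolding norm_mult using e(1) by (simp add: c_def norm_divide)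
        then have "norm (\<phi> y - \<phi> x) \<le> e / 2"
          using e(1) by (simp add: field_simps)
        then have "norm (\<phi> y - \<phi> x) < e"
          using e(1) by simp
        then show "y \<in> {x \<in> topspace X. \<phi> x \<in> B}"
          using e(2) y' by simp
      qed
      ultimately show "\<exists>G. openin X G \<and> x \<in> G \<and> G \<subseteq> {x \<in> topspace X. \<phi> x \<in> B}"
        by blast
    qed
  qed simp
  then show ?thesis
    using add scale le by (auto simp: polar_def dual_def is_operator_def)
qed

lemma zero_in_polar: "U \<in> closed_ac_nhds_0 smul X \<Longrightarrow> (\<lambda>x. 0) \<in> polar smul X U"
  by (rule linear_in_polarI) auto

text \<open>
  The series converges absolutely on \<open>U\<close>, with sum of absolute value at most 1, and hence
  pointwise on the whole space because \<open>U\<close> is absorbing.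
\<close>

lemma polar_countable_combination:
  fixes c :: "nat \<Rightarrow> real"
  assumes U: "U \<in> closed_ac_nhds_0 smul X" and \<phi>: "\<And>j. \<phi> j \<in> polar smul X U"
    and c: "summable (\<lambda>j. \<bar>c j\<bar>)" "(\<Sum>j. \<bar>c j\<bar>) \<le> 1"
  shows "(\<lambda>x. \<Sum>j. of_real (c j) * \<phi> j x) \<in> polar smul X U"
proof -
  have dual: "\<phi> j \<in> dual smul X" for j
    using \<phi> by (simp add: polar_def)
  have le: "norm (\<phi> j x) \<le> 1" if "x \<in> U" for j x
    using \<phi> that by (simp add: polar_def)
  have on_U: "summable (\<lambda>j. of_real (c j) * \<phi> j x)" if "x \<in> U" for x
  proof (rule summable_scalar_norm_cancel, rule summable_comparison_test'[OF c(1)])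
    show "norm (norm (of_real (c j) * \<phi> j x)) \<le> \<bar>c j\<bar>" for j
      using le[OF that, of j] by (simp add: norm_mult mult_left_le)
  qed
  have sm: "summable (\<lambda>j. of_real (c j) * \<phi> j x)" if x: "x \<in> topspace X" for x
  proof -
    obtain t :: real where t: "t > 0" "smul (of_real t) x \<in> U"
      using nhds_0_absorbing[OF U x] .
    have "(\<lambda>j. of_real (c j) * \<phi> j x) = (\<lambda>j. of_real (1 / t) * (of_real (c j) * \<phi> j (smul (of_real t) x)))"
      using t(1) by (simp add: dual_scale[OF dual x])
    then show ?thesis
      using summable_mult[OF on_U[OF t(2)], of "of_real (1 / t)"] by simp
  qed
  show ?thesis
  proof (rule linear_in_polarI[OF U])
    fix x y assume xy: "x \<in> topspace X" "y \<in> topspace X"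
    show "(\<Sum>j. of_real (c j) * \<phi> j (x + y)) = (\<Sum>j. of_real (c j) * \<phi> j x) + (\<Sum>j. of_real (c j) * \<phi> j y)"
      by (subst suminf_add[OF sm sm]) (simp_all add: xy dual_add[OF dual] distrib_left)
  next
    fix a x assume x: "x \<in> topspace X"
    show "(\<Sum>j. of_real (c j) * \<phi> j (smul a x)) = a * (\<Sum>j. of_real (c j) * \<phi> j x)"
      by (subst suminf_mult[OF sm[OF x], symmetric]) (simp add: dual_scale[OF dual x] mult.left_commute)
  next
    fix x assume x: "x \<in> U"
    have "(\<lambda>n. norm (\<Sum>j<n. of_real (c j) * \<phi> j x)) \<longlonglongrightarrow> norm (\<Sum>j. of_real (c j) * \<phi> j x)"
      using summable_LIMSEQ[OF on_U[OF x]] by (rule tendsto_norm)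
    moreover have "norm (\<Sum>j<n. of_real (c j) * \<phi> j x) \<le> 1" for n
    proof -
      have "norm (\<Sum>j<n. of_real (c j) * \<phi> j x) \<le> (\<Sum>j<n. \<bar>c j\<bar>)"
        using le[OF x] by (intro sum_norm_le) (simp add: norm_mult mult_left_le)
      also have "\<dots> \<le> (\<Sum>j. \<bar>c j\<bar>)"
        using c(1) by (intro sum_le_suminf) auto
      finally show ?thesis using c(2) by simp
    qed
    ultimately show "norm (\<Sum>j. of_real (c j) * \<phi> j x) \<le> 1"
      by (intro LIMSEQ_le_const2) auto
  qed
qed

end

section \<open>Weakly summable sequences\<close>

locale weak_sequences = locally_convex_space +
  fixes p :: real
  assumes p: "p \<ge> 1"
begin

abbreviation "\<N> \<equiv> closed_ac_nhds_0 smul X"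
abbreviation "V \<equiv> weakly_summable_seqs smul X p"
abbreviation "\<rho> \<equiv> weak_seminorm smul X p"

lemma p_pos: "p > 0"
  using p by simp

lemma seq_nth: "x \<in> V \<Longrightarrow> x n \<in> topspace X"
  by (simp add: weakly_summable_seqs_def)

lemma seq_weakly_summable: "\<lbrakk>x \<in> V; \<phi> \<in> dual smul X\<rbrakk> \<Longrightarrow> lp_summable p (\<lambda>n. \<phi> (x n))"
  by (simp add: weakly_summable_seqs_def)

lemma polar_dual: "\<phi> \<in> polar smul X U \<Longrightarrow> \<phi> \<in> dual smul X"
  by (simp add: polar_def)

text \<open>
  Uniform boundedness, applied to the set of the sequences of values of the functionals in the
  polar; each coordinate is bounded because \<open>U\<close> is absorbing.
\<close>

lemma polar_bounded_on_seq:
  assumes U: "U \<in> \<N>" and x: "x \<in> V"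
  shows "\<exists>M. \<forall>\<phi>\<in>polar smul X U. lp_norm p (\<lambda>n. \<phi> (x n)) \<le> M"
proof -
  define K where "K = (\<lambda>\<phi> n. \<phi> (x n)) ` polar smul X U"
  have "\<exists>M. \<forall>a\<in>K. lp_norm p a \<le> M"
  proof (rule bounded_if_countably_absolutely_convex[OF p])
    show "lp_summable p a" if "a \<in> K" for a
      using that seq_weakly_summable[OF x] polar_dual by (auto simp: K_def)
    show "\<exists>M. \<forall>a\<in>K. norm (a n) \<le> M" for n
    proof -
      obtain t :: real where t: "t > 0" "smul (of_real t) (x n) \<in> U"
        using nhds_0_absorbing[OF U seq_nth[OF x]] .
      have "norm (\<phi> (x n)) \<le> 1 / t" if \<phi>: "\<phi> \<in> polar smul X U" for \<phi>
      proof -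
        have "norm (\<phi> (smul (of_real t) (x n))) \<le> 1"
          using \<phi> t by (simp add: polar_def)
        then show ?thesis
          using t by (simp add: dual_scale[OF polar_dual[OF \<phi>] seq_nth[OF x]] norm_mult field_simps)
      qed
      then show ?thesis by (auto simp: K_def)
    qed
    fix b :: "nat \<Rightarrow> nat \<Rightarrow> 'a" and c :: "nat \<Rightarrow> real"
    assume b: "\<And>j. b j \<in> K" and c: "summable (\<lambda>j. \<bar>c j\<bar>)" "(\<Sum>j. \<bar>c j\<bar>) \<le> 1"
    have "\<forall>j. \<exists>\<phi>. \<phi> \<in> polar smul X U \<and> b j = (\<lambda>n. \<phi> (x n))"
      using b by (auto simp: K_def)
    from choice[OF this] obtain \<phi> where
      \<phi>: "\<And>j. \<phi> j \<in> polar smul X U" "\<And>j. b j = (\<lambda>n. \<phi> j (x n))"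
      by blast
    show "(\<lambda>n. \<Sum>j. of_real (c j) * b j n) \<in> K"
      unfolding K_def \<phi>(2)
      by (rule image_eqI[OF _ polar_countable_combination[OF U \<phi>(1) c]]) simp
  qed
  then show ?thesis
    by (simp add: K_def)
qed

lemma weak_seminorm_eq: "\<rho> U x = (SUP \<phi>\<in>polar smul X U. lp_norm p (\<lambda>n. \<phi> (x n)))"
  by (simp add: weak_seminorm_def lp_norm_def)

lemma le_weak_seminorm:
  assumes "U \<in> \<N>" "x \<in> V" "\<phi> \<in> polar smul X U"
  shows "lp_norm p (\<lambda>n. \<phi> (x n)) \<le> \<rho> U x"
proof -
  obtain M where "\<forall>\<phi>\<in>polar smul X U. lp_norm p (\<lambda>n. \<phi> (x n)) \<le> M"
    using polar_bounded_on_seq[OF assms(1,2)] by blast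
  then show ?thesis
    unfolding weak_seminorm_eq using assms(3) by (intro cSUP_upper bdd_aboveI2[where M = M]) auto
qed

lemma weak_seminorm_le:
  assumes "U \<in> \<N>" "\<And>\<phi>. \<phi> \<in> polar smul X U \<Longrightarrow> lp_norm p (\<lambda>n. \<phi> (x n)) \<le> C"
  shows "\<rho> U x \<le> C"
  unfolding weak_seminorm_eq using assms zero_in_polar by (intro cSUP_least) auto

lemma weak_seminorm_nonneg: "\<lbrakk>U \<in> \<N>; x \<in> V\<rbrakk> \<Longrightarrow> 0 \<le> \<rho> U x"
  using le_weak_seminorm zero_in_polar lp_norm_nonneg order_trans by blast

lemma seq_add:
  assumes "x \<in> V" "y \<in> V"
  shows "x + y \<in> V"
  unfolding weakly_summable_seqs_def
proof (intro CollectI conjI allI ballI)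
  show "(x + y) n \<in> topspace X" for n
    using assms by (simp add: carrier_closed(2) seq_nth)
  show "lp_summable p (\<lambda>n. \<phi> ((x + y) n))" if \<phi>: "\<phi> \<in> dual smul X" for \<phi>
    using lp_add(1)[OF p seq_weakly_summable[OF assms(1) \<phi>] seq_weakly_summable[OF assms(2) \<phi>]]
    by (simp add: dual_add[OF \<phi> seq_nth[OF assms(1)] seq_nth[OF assms(2)]])
qed

lemma seq_scale:
  assumes x: "x \<in> V"
  shows "seq_smul smul c x \<in> V"
  unfolding weakly_summable_seqs_def
proof (intro CollectI conjI allI ballI)
  show "seq_smul smul c x n \<in> topspace X" for n
    using seq_nth[OF x] carrier_closed(3) by (simp add: seq_smul_def)
  show "lp_summable p (\<lambda>n. \<phi> (seq_smul smul c x n))" if \<phi>: "\<phi> \<in> dual smul X" for \<phi>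
    by (rule lp_scale(1)[OF p_pos norm_ge_zero[of c] _ seq_weakly_summable[OF x \<phi>]])
      (simp add: seq_smul_def dual_scale[OF \<phi> seq_nth[OF x]] norm_mult)
qed

lemma seq_finite:
  assumes "\<And>n. x n \<in> topspace X" "\<And>n. n \<ge> N \<Longrightarrow> x n = 0"
  shows "x \<in> V"
  unfolding weakly_summable_seqs_def
proof (intro CollectI conjI allI ballI)
  show "x n \<in> topspace X" for n
    by (rule assms(1))
  show "lp_summable p (\<lambda>n. \<phi> (x n))" if \<phi>: "\<phi> \<in> dual smul X" for \<phi>
    by (rule lp_finite_support(1)[of "{..<N}"]) (auto simp: assms(2) dual_0[OF \<phi>])
qed

lemma vector_space_seq_smul: "vector_space (seq_smul smul)"
  by unfold_locales
    (auto simp: seq_smul_def fun_eq_iff scale_right_distrib scale_left_distrib)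

lemma subspace_seqs: "module.subspace (seq_smul smul) V"
proof -
  interpret S: vector_space "seq_smul smul" by (rule vector_space_seq_smul)
  show ?thesis
    unfolding S.subspace_def using seq_add seq_scale seq_finite[of 0 0] carrier_closed(1) by auto
qed

lemma seq_diff: "\<lbrakk>x \<in> V; y \<in> V\<rbrakk> \<Longrightarrow> x - y \<in> V"
proof -
  interpret S: vector_space "seq_smul smul" by (rule vector_space_seq_smul)
  show "\<lbrakk>x \<in> V; y \<in> V\<rbrakk> \<Longrightarrow> x - y \<in> V"
    by (rule S.subspace_diff[OF subspace_seqs])
qed

lemma weak_seminorm_add:
  assumes U: "U \<in> \<N>" and xy: "x \<in> V" "y \<in> V"
  shows "\<rho> U (x + y) \<le> \<rho> U x + \<rho> U y"
proof (rule weak_seminorm_le[OF U])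
  fix \<phi> assume \<phi>: "\<phi> \<in> polar smul X U"
  have "lp_norm p (\<lambda>n. \<phi> ((x + y) n)) = lp_norm p (\<lambda>n. \<phi> (x n) + \<phi> (y n))"
    using xy by (simp add: dual_add[OF polar_dual[OF \<phi>]] seq_nth)
  also have "\<dots> \<le> lp_norm p (\<lambda>n. \<phi> (x n)) + lp_norm p (\<lambda>n. \<phi> (y n))"
    using xy polar_dual[OF \<phi>] by (intro lp_add(2)[OF p] seq_weakly_summable)
  also have "\<dots> \<le> \<rho> U x + \<rho> U y"
    using xy by (intro add_mono le_weak_seminorm[OF U _ \<phi>])
  finally show "lp_norm p (\<lambda>n. \<phi> ((x + y) n)) \<le> \<rho> U x + \<rho> U y" .
qed

lemma weak_seminorm_scale_le:
  assumes U: "U \<in> \<N>" and x: "x \<in> V"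
  shows "\<rho> U (seq_smul smul c x) \<le> norm c * \<rho> U x"
proof (rule weak_seminorm_le[OF U])
  fix \<phi> assume \<phi>: "\<phi> \<in> polar smul X U"
  have "lp_norm p (\<lambda>n. \<phi> (seq_smul smul c x n)) = norm c * lp_norm p (\<lambda>n. \<phi> (x n))"
    by (rule lp_scale(2)[OF p_pos norm_ge_zero[of c] _ seq_weakly_summable[OF x polar_dual[OF \<phi>]]])
      (simp add: seq_smul_def dual_scale[OF polar_dual[OF \<phi>] seq_nth[OF x]] norm_mult)
  then show "lp_norm p (\<lambda>n. \<phi> (seq_smul smul c x n)) \<le> norm c * \<rho> U x"
    using le_weak_seminorm[OF U x \<phi>] by (simp add: mult_left_mono)
qed

lemma weak_seminorm_antimono:
  assumes "U \<in> \<N>" "W \<in> \<N>" "W \<subseteq> U" "x \<in> V"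
  shows "\<rho> U x \<le> \<rho> W x"
  using assms by (intro weak_seminorm_le le_weak_seminorm) (auto simp: polar_def)

lemma directed_weak_seminorms: "directed_seminorms V (\<rho> ` \<N>)"
proof
  show "x - y \<in> V" if "x \<in> V" "y \<in> V" for x y
    using that by (rule seq_diff)
  show "\<sigma> 0 = 0" if \<sigma>: "\<sigma> \<in> \<rho> ` \<N>" for \<sigma>
  proof -
    obtain U where U: "U \<in> \<N>" "\<sigma> = \<rho> U"
      using \<sigma> by blast
    have "lp_norm p (\<lambda>n. \<phi> ((0 :: nat \<Rightarrow> 'b) n)) \<le> 0" if "\<phi> \<in> polar smul X U" for \<phi>
      by (simp add: dual_0[OF polar_dual[OF that]] lp_norm_def)
    then have "\<rho> U 0 \<le> 0"
      by (rule weak_seminorm_le[OF U(1)])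
    then show ?thesis
      using weak_seminorm_nonneg[OF U(1) seq_finite[of 0 0]] U(2) carrier_closed(1) by simp
  qed
  show "\<sigma> (x + y) \<le> \<sigma> x + \<sigma> y" if "\<sigma> \<in> \<rho> ` \<N>" "x \<in> V" "y \<in> V" for \<sigma> x y
    using that weak_seminorm_add by blast
  show "\<rho> ` \<N> \<noteq> {}"
    using topspace_in_nhds_0 by blast
  fix \<sigma> \<tau> assume "\<sigma> \<in> \<rho> ` \<N>" "\<tau> \<in> \<rho> ` \<N>"
  then obtain U W where UW: "U \<in> \<N>" "\<sigma> = \<rho> U" "W \<in> \<N>" "\<tau> = \<rho> W"
    by blast
  have "\<forall>x\<in>V. \<sigma> x \<le> \<rho> (U \<inter> W) x \<and> \<tau> x \<le> \<rho> (U \<inter> W) x"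
    using UW Int_in_nhds_0[OF UW(1,3)] by (auto intro: weak_seminorm_antimono)
  then show "\<exists>\<upsilon>\<in>\<rho> ` \<N>. \<forall>x\<in>V. \<sigma> x \<le> \<upsilon> x \<and> \<tau> x \<le> \<upsilon> x"
    using Int_in_nhds_0[OF UW(1,3)] by blast
qed

end

section \<open>Operators on weakly summable sequences\<close>

locale operator_on_weak_sequences = weak_sequences smul X p
  for smul :: "'k::real_or_complex \<Rightarrow> 'e::ab_group_add \<Rightarrow> 'e" and X p +
  fixes smulL :: "'k \<Rightarrow> 'l::banach \<Rightarrow> 'l" and T :: "'e \<Rightarrow> 'l" and q :: real
  assumes L: "banach_space_over smulL"
    and T: "is_operator smul X smulL euclidean T"
    and q: "q \<ge> 1"
begin

lemma q_pos: "q > 0"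
  using q by simp

lemma T_add: "\<lbrakk>x \<in> topspace X; y \<in> topspace X\<rbrakk> \<Longrightarrow> T (x + y) = T x + T y"
  using T by (simp add: is_operator_def)

lemma T_0: "T 0 = 0"
  using T_add[of 0 0] carrier_closed(1) by simp

lemma T_diff: "\<lbrakk>x \<in> topspace X; y \<in> topspace X\<rbrakk> \<Longrightarrow> T (x - y) = T x - T y"
  using T_add[of "x - y" y] carrier_closed(5) by simp

lemma norm_T_scale: "x \<in> topspace X \<Longrightarrow> norm (T (smul c x)) = norm c * norm (T x)"
  using T banach_space_over.norm_smul[OF L] by (simp add: is_operator_def)

lemma strong_norm_eq: "strong_norm q y = lp_norm q y"
  by (simp add: strong_norm_def lp_norm_def)

definition T_ball :: "'e set"
  where "T_ball = {x \<in> topspace X. norm (T x) \<le> 1}"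

lemma T_ball_in_nhds_0: "T_ball \<in> \<N>"
proof -
  have cont: "continuous_map X euclidean T"
    using T by (simp add: is_operator_def)
  have "closedin X {x \<in> topspace X. T x \<in> cball 0 1}"
    using cont by (rule closedin_continuous_map_preimage) simp
  then have "closedin X T_ball"
    by (simp add: T_ball_def)
  moreover have "openin X {x \<in> topspace X. T x \<in> ball 0 1}"
    using cont by (rule openin_continuous_map_preimage) simp
  moreover have "0 \<in> {x \<in> topspace X. T x \<in> ball 0 1}"
    by (simp add: carrier_closed(1) T_0)
  moreover have "{x \<in> topspace X. T x \<in> ball 0 1} \<subseteq> T_ball"
    by (auto simp: T_ball_def)
  moreover have "absolutely_convex smul T_ball"
    unfolding absolutely_convex_def
  proof (intro ballI allI impI)
    fix x y and a b :: 'k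
    assume x: "x \<in> T_ball" and y: "y \<in> T_ball" and ab: "norm a + norm b \<le> 1"
    have "norm (T (smul a x + smul b y)) \<le> norm (T (smul a x)) + norm (T (smul b y))"
      using x y carrier_closed(3) by (simp add: T_ball_def T_add norm_triangle_ineq)
    also have "\<dots> \<le> norm a * 1 + norm b * 1"
      using x y by (intro add_mono) (auto simp: T_ball_def norm_T_scale intro: mult_left_le)
    finally show "smul a x + smul b y \<in> T_ball"
      using x y ab carrier_closed by (simp add: T_ball_def)
  qed
  ultimately show ?thesis
    unfolding closed_ac_nhds_0_def by blast
qed

text \<open>
  Some linear functional is dominated by the norm of \<open>T\<close>, hence lies in the polar of \<open>T_ball\<close>,
  and has the absolute value \<open>norm (T (y n))\<close> at \<open>y n\<close>.
\<close>

lemma norm_T_le_weak_seminorm: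
  assumes y: "y \<in> V"
  shows "norm (T (y n)) \<le> \<rho> T_ball y"
proof -
  obtain \<phi> where \<phi>: "\<And>x z. \<lbrakk>x \<in> topspace X; z \<in> topspace X\<rbrakk> \<Longrightarrow> \<phi> (x + z) = \<phi> x + \<phi> z"
    "\<And>c x. x \<in> topspace X \<Longrightarrow> \<phi> (smul c x) = c * \<phi> x"
    "\<And>x. x \<in> topspace X \<Longrightarrow> norm (\<phi> x) \<le> norm (T x)" "norm (\<phi> (y n)) = norm (T (y n))"
    by (rule seminorm_Hahn_Banach[OF vector_space_axioms subspace_topspace _ _ seq_nth[OF y, of n],
          where s = "\<lambda>x. norm (T x)"])
      (auto simp: T_add norm_T_scale norm_triangle_ineq)
  have polar: "\<phi> \<in> polar smul X T_ball"
    by (rule linear_in_polarI[OF T_ball_in_nhds_0 \<phi>(1,2)])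
      (auto simp: T_ball_def intro: order_trans[OF \<phi>(3)])
  have "norm (\<phi> (y n)) \<le> lp_norm p (\<lambda>n. \<phi> (y n))"
    by (rule norm_le_lp_norm[OF p_pos seq_weakly_summable[OF y polar_dual[OF polar]]])
  also have "\<dots> \<le> \<rho> T_ball y"
    by (rule le_weak_seminorm[OF T_ball_in_nhds_0 y polar])
  finally show ?thesis
    by (simp add: \<phi>(4))
qed

lemma hat_diff: "\<lbrakk>x \<in> V; y \<in> V\<rbrakk> \<Longrightarrow> hat T (x - y) = hat T x - hat T y"
  by (auto simp: hat_def fun_eq_iff T_diff seq_nth)

text \<open>
  Continuity of the map between sequence spaces, the summing property and the conclusion from
  barrelledness are each related to this estimate.
\<close>

definition hat_bounded :: "'e set \<Rightarrow> bool"
  where "hat_bounded U \<longleftrightarrow>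
    (\<exists>C>0. \<forall>y\<in>V. lp_summable q (hat T y) \<and> lp_norm q (hat T y) \<le> C * \<rho> U y)"

text \<open>
  By homogeneity. Scaling with \<open>\<delta> / r\<close> for all \<open>r > \<rho> U y\<close>, instead of with \<open>\<delta> / \<rho> U y\<close>,
  covers sequences on which the seminorm vanishes.
\<close>

lemma hat_boundedI:
  assumes U: "U \<in> \<N>" and "\<delta> > 0"
    and unit: "\<And>y. \<lbrakk>y \<in> V; \<rho> U y < \<delta>\<rbrakk> \<Longrightarrow> lp_norm q (hat T y) \<le> 1"
    and summ: "\<And>y. y \<in> V \<Longrightarrow> lp_summable q (hat T y)"
  shows "hat_bounded U"
proof -
  have "lp_norm q (hat T y) \<le> 1 / \<delta> * \<rho> U y" if y: "y \<in> V" for y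
  proof -
    have "\<delta> * lp_norm q (hat T y) \<le> r" if r: "r > \<rho> U y" for r
    proof -
      have r0: "r > 0"
        using r weak_seminorm_nonneg[OF U y] by simp
      define c where "c = \<delta> / r"
      have c: "c > 0"
        using r0 \<open>\<delta> > 0\<close> by (simp add: c_def)
      have "\<rho> U (seq_smul smul (of_real c) y) \<le> c * \<rho> U y"
        using weak_seminorm_scale_le[OF U y, of "of_real c"] c by simp
      also have "\<dots> < c * r"
        using r c by simp
      finally have "lp_norm q (hat T (seq_smul smul (of_real c) y)) \<le> 1"
        using r0 by (intro unit seq_scale y) (simp add: c_def)
      moreover have "lp_norm q (hat T (seq_smul smul (of_real c) y)) = c * lp_norm q (hat T y)"
        by (rule lp_scale(2)[OF q_pos _ _ summ[OF y]])
          (use c in \<open>auto simp: hat_def seq_smul_def norm_T_scale[OF seq_nth[OF y]]\<close>)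
      ultimately have "c * lp_norm q (hat T y) \<le> 1"
        by simp
      then show ?thesis
        using r0 by (simp add: c_def pos_divide_le_eq)
    qed
    then have "\<delta> * lp_norm q (hat T y) \<le> \<rho> U y"
      by (rule dense_ge)
    then show ?thesis
      using \<open>\<delta> > 0\<close> by (simp add: field_simps)
  qed
  then show ?thesis
    unfolding hat_bounded_def using summ \<open>\<delta> > 0\<close> by (intro exI[of _ "1 / \<delta>"]) auto
qed

lemma continuous_hat_iff:
  "continuous_map (weak_lp smul X p) (strong_lq q) (hat T) \<longleftrightarrow> (\<exists>U\<in>\<N>. hat_bounded U)"
proof -
  have iff: "continuous_map (weak_lp smul X p) (strong_lq q) (hat T) \<longleftrightarrow>
    (\<forall>y\<in>V. lp_summable q (hat T y)) \<and>
    (\<forall>\<epsilon>>0. \<exists>U\<in>\<N>. \<exists>\<delta>>0. \<forall>y\<in>V. \<rho> U y < \<delta> \<longrightarrow> lp_norm q (hat T y) < \<epsilon>)"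
    unfolding weak_lp_def strong_lq_def
    by (subst continuous_map_seminorm_topology_iff[where f = "hat T", OF directed_weak_seminorms
          directed_seminorms_strong_norm[OF q] hat_diff])
      (simp_all add: strongly_summable_seqs_def strong_norm_eq)
  show ?thesis
  proof
    assume "continuous_map (weak_lp smul X p) (strong_lq q) (hat T)"
    then obtain U \<delta> where "U \<in> \<N>" "\<delta> > 0" "\<forall>y\<in>V. \<rho> U y < \<delta> \<longrightarrow> lp_norm q (hat T y) < 1"
      "\<forall>y\<in>V. lp_summable q (hat T y)"
      unfolding iff by (meson zero_less_one)
    then have "hat_bounded U"
      by (intro hat_boundedI) (auto intro: less_imp_le)
    with \<open>U \<in> \<N>\<close> show "\<exists>U\<in>\<N>. hat_bounded U" ..
  next
    assume "\<exists>U\<in>\<N>. hat_bounded U"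
    then obtain U where U: "U \<in> \<N>" "hat_bounded U"
      by blast
    then obtain C where C: "C > 0"
      "\<forall>y\<in>V. lp_summable q (hat T y) \<and> lp_norm q (hat T y) \<le> C * \<rho> U y"
      unfolding hat_bounded_def by blast
    have "\<exists>U\<in>\<N>. \<exists>\<delta>>0. \<forall>y\<in>V. \<rho> U y < \<delta> \<longrightarrow> lp_norm q (hat T y) < \<epsilon>" if e: "\<epsilon> > 0" for \<epsilon>
    proof -
      have "lp_norm q (hat T y) < \<epsilon>" if "y \<in> V" "\<rho> U y < \<epsilon> / C" for y
      proof -
        have "C * \<rho> U y < \<epsilon>"
          using that C(1) by (simp add: field_simps)
        then show ?thesis
          using C(2) that(1) by fastforce
      qed
      then show ?thesis
        using U(1) e C(1) by (intro bexI[of _ U] exI[of _ "\<epsilon> / C"]) auto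
    qed
    moreover have "\<forall>y\<in>V. lp_summable q (hat T y)"
      using C(2) by simp
    ultimately show "continuous_map (weak_lp smul X p) (strong_lq q) (hat T)"
      by (simp add: iff)
  qed
qed

text \<open>
  A finite family in \<open>U\<close> is a finitely supported sequence, which gives one direction. Conversely,
  an initial segment of a sequence is scaled into the absorbing set \<open>U\<close>, both sides of the
  summing inequality being homogeneous, and the bound does not depend on the length of the segment.
\<close>

lemma hat_bounded_iff_summing:
  assumes U: "U \<in> \<N>"
  shows "hat_bounded U \<longleftrightarrow> U_qp_summing smul X U q p T"
proof
  assume "hat_bounded U"
  then obtain C where C: "C > 0" "\<And>y. y \<in> V \<Longrightarrow> lp_norm q (hat T y) \<le> C * \<rho> U y"
    unfolding hat_bounded_def by blast
  have "(\<Sum>i\<le>n. norm (T (x i)) powr q) powr (1 / q)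
      \<le> C * (SUP \<phi>\<in>polar smul X U. (\<Sum>i\<le>n. norm (\<phi> (x i)) powr p) powr (1 / p))"
    if x: "\<forall>i\<le>n. x i \<in> U" for n and x :: "nat \<Rightarrow> 'e"
  proof -
    have y: "trunc (Suc n) x \<in> V"
      using x nhds_0_subset[OF U] carrier_closed(1)
      by (intro seq_finite[of _ "Suc n"]) (auto simp: trunc_def less_Suc_eq_le)
    have finite: "lp_norm r (\<lambda>i. f (trunc (Suc n) x i)) = (\<Sum>i\<le>n. norm (f (x i)) powr r) powr (1 / r)"
      if "f 0 = 0" for f :: "'e \<Rightarrow> 'c::real_normed_vector" and r
    proof -
      have "(\<lambda>i. f (trunc (Suc n) x i)) = trunc (Suc n) (\<lambda>i. f (x i))"
        using that by (auto simp: trunc_def)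
      then show ?thesis
        by (simp only: lp_norm_trunc lessThan_Suc_atMost)
    qed
    have "\<rho> U (trunc (Suc n) x)
        = (SUP \<phi>\<in>polar smul X U. (\<Sum>i\<le>n. norm (\<phi> (x i)) powr p) powr (1 / p))"
      unfolding weak_seminorm_eq by (intro SUP_cong[OF refl] finite[OF dual_0[OF polar_dual]])
    then show ?thesis
      using C(2)[OF y] finite[of T q, OF T_0] by (simp add: hat_def)
  qed
  then show "U_qp_summing smul X U q p T"
    unfolding U_qp_summing_def using C(1) by blast
next
  assume "U_qp_summing smul X U q p T"
  then obtain C where C: "C > 0" "\<forall>(n::nat) x. (\<forall>i\<le>n. x i \<in> U) \<longrightarrow>
      (\<Sum>i\<le>n. norm (T (x i)) powr q) powr (1 / q)
        \<le> C * (SUP \<phi>\<in>polar smul X U. (\<Sum>i\<le>n. norm (\<phi> (x i)) powr p) powr (1 / p))"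
    unfolding U_qp_summing_def by blast
  have ac: "absolutely_convex smul U"
    using U by (simp add: closed_ac_nhds_0_def)
  have bound: "lp_norm q (trunc (Suc n) (hat T y)) \<le> C * \<rho> U y" if y: "y \<in> V" for n y
  proof -
    have "\<exists>t>0. \<forall>i\<le>n. smul (of_real t) (y i) \<in> U"
    proof -
      have "\<forall>i. \<exists>t::real. t > 0 \<and> smul (of_real t) (y i) \<in> U"
        using nhds_0_absorbing[OF U seq_nth[OF y]] by metis
      from choice[OF this] obtain s :: "nat \<Rightarrow> real"
        where s: "\<And>i. s i > 0" "\<And>i. smul (of_real (s i)) (y i) \<in> U"
        by blast
      define t where "t = Min (s ` {..n})"
      have t: "t > 0"
        using s(1) by (simp add: t_def)
      have "smul (of_real t) (y i) \<in> U" if "i \<le> n" for i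
      proof -
        have "t \<le> s i"
          using that by (simp add: t_def)
        then have "smul (of_real (t / s i)) (smul (of_real (s i)) (y i)) \<in> U"
          using t s(1)[of i]
          by (intro absolutely_convex_balanced[OF ac s(2)]) (simp add: norm_divide)
        moreover have "of_real (t / s i) * of_real (s i) = (of_real t :: 'k)"
          unfolding of_real_mult[symmetric] using s(1)[of i] by simp
        ultimately show ?thesis
          by (simp only: scale_scale)
      qed
      with t show ?thesis by blast
    qed
    then obtain t where t: "t > 0" "\<forall>i\<le>n. smul (of_real t) (y i) \<in> U" by blast
    have scaled: "(\<Sum>i\<le>n. norm (f (smul (of_real t) (y i))) powr r) powr (1 / r)
        = t * lp_norm r (trunc (Suc n) (\<lambda>i. f (y i)))"
      if r: "r > 0" and f: "\<And>i. norm (f (smul (of_real t) (y i))) = t * norm (f (y i))"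
      for f :: "'e \<Rightarrow> 'c::real_normed_vector" and r
    proof -
      have "lp_norm r (trunc (Suc n) (\<lambda>i. f (smul (of_real t) (y i)))) = t * lp_norm r (trunc (Suc n) (\<lambda>i. f (y i)))"
        using t by (intro lp_scale(2)[OF r _ _ lp_summable_trunc]) (auto simp: trunc_def f)
      then show ?thesis
        by (simp only: lp_norm_trunc lessThan_Suc_atMost)
    qed
    have "t * lp_norm q (trunc (Suc n) (\<lambda>i. T (y i)))
        = (\<Sum>i\<le>n. norm (T (smul (of_real t) (y i))) powr q) powr (1 / q)"
      using t(1) by (intro scaled[symmetric] q_pos) (simp add: norm_T_scale[OF seq_nth[OF y]])
    also have "\<dots> \<le> C * (SUP \<phi>\<in>polar smul X U. (\<Sum>i\<le>n. norm (\<phi> (smul (of_real t) (y i))) powr p) powr (1 / p))"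
      using C(2)[THEN spec, THEN spec, of n "\<lambda>i. smul (of_real t) (y i)"] t(2) by simp
    also have "\<dots> \<le> C * (t * \<rho> U y)"
    proof (intro mult_left_mono cSUP_least)
      fix \<phi> assume \<phi>: "\<phi> \<in> polar smul X U"
      have "(\<Sum>i\<le>n. norm (\<phi> (smul (of_real t) (y i))) powr p) powr (1 / p)
          = t * lp_norm p (trunc (Suc n) (\<lambda>i. \<phi> (y i)))"
        using t(1) by (intro scaled p_pos)
          (simp add: dual_scale[OF polar_dual[OF \<phi>] seq_nth[OF y]] norm_mult)
      also have "\<dots> \<le> t * \<rho> U y"
        using t(1) lp_norm_trunc_le[OF p_pos seq_weakly_summable[OF y polar_dual[OF \<phi>]], of "Suc n"]
          le_weak_seminorm[OF U y \<phi>]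
        by (intro mult_left_mono) auto
      finally show "(\<Sum>i\<le>n. norm (\<phi> (smul (of_real t) (y i))) powr p) powr (1 / p) \<le> t * \<rho> U y" .
    qed (use C(1) zero_in_polar[OF U] in auto)
    finally show ?thesis
      using t(1) by (simp add: hat_def mult.left_commute)
  qed
  have "lp_norm q (trunc N (hat T y)) \<le> C * \<rho> U y" if y: "y \<in> V" for N y
  proof (cases N)
    case 0
    then show ?thesis
      using C(1) weak_seminorm_nonneg[OF U y] by (simp add: lp_norm_trunc)
  next
    case (Suc n)
    then show ?thesis using bound[OF y] by simp
  qed
  from lp_norm_le_if_trunc_le[OF q_pos this]
  have "\<forall>y\<in>V. lp_summable q (hat T y) \<and> lp_norm q (hat T y) \<le> C * \<rho> U y"
    by simp
  then show "hat_bounded U"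
    unfolding hat_bounded_def using C(1) by blast
qed

text \<open>
  Consider all linear functionals on the sequence space that are dominated, for some \<open>N\<close>, by the
  \<open>q\<close>-norm of the first \<open>N\<close> terms of \<open>hat T y\<close>. Each of them is continuous, since every
  \<open>norm (T (y n))\<close> is at most \<open>\<rho> T_ball y\<close>. At a fixed \<open>y\<close> all of them are bounded by the
  \<open>q\<close>-norm of \<open>hat T y\<close>, which is finite because \<open>T\<close> is convergent. Barrelledness makes them
  equicontinuous, and by the Hahn--Banach theorem their supremum at \<open>y\<close> is the norm of
  \<open>hat T y\<close>.
\<close>

lemma barrelled_imp_hat_bounded:
  assumes barrelled: "barrelled (seq_smul smul) (weak_lp smul X p)"
    and conv: "qp_convergent smul X q p T"
  obtains U where "U \<in> \<N>" "hat_bounded U"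
proof -
  interpret P: directed_seminorms V "\<rho> ` \<N>" by (rule directed_weak_seminorms)
  interpret S: vector_space "seq_smul smul" by (rule vector_space_seq_smul)
  have V0: "0 \<in> V"
    by (rule S.subspace_0[OF subspace_seqs])
  have summ: "lp_summable q (hat T y)" if "y \<in> V" for y
    using conv that by (simp add: qp_convergent_def hat_def)
  define s where "s N y = lp_norm q (trunc N (hat T y))" for N y
  have s_add: "s N (x + y) \<le> s N x + s N y" if "x \<in> V" "y \<in> V" for N x y
  proof -
    have "trunc N (hat T (x + y)) = (\<lambda>n. trunc N (hat T x) n + trunc N (hat T y) n)"
      using that by (auto simp: trunc_def hat_def fun_eq_iff T_add seq_nth)
    then show ?thesis
      unfolding s_def by (simp add: lp_add(2)[OF q lp_summable_trunc lp_summable_trunc])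
  qed
  have s_scale: "s N (seq_smul smul c x) = norm c * s N x" if "x \<in> V" for N c x
    unfolding s_def
    by (rule lp_scale(2)[OF q_pos norm_ge_zero _ lp_summable_trunc])
      (simp add: trunc_def hat_def seq_smul_def norm_T_scale[OF seq_nth[OF that]])
  have s_le: "s N y \<le> real N powr (1 / q) * \<rho> T_ball y" if y: "y \<in> V" for N y
  proof -
    have nonneg: "0 \<le> \<rho> T_ball y"
      by (rule weak_seminorm_nonneg[OF T_ball_in_nhds_0 y])
    have "(\<Sum>i<N. norm (hat T y i) powr q) \<le> (\<Sum>i<N. \<rho> T_ball y powr q)"
      using norm_T_le_weak_seminorm[OF y] q_pos by (intro sum_mono powr_mono2) (auto simp: hat_def)
    then have "s N y \<le> (real N * \<rho> T_ball y powr q) powr (1 / q)"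
      unfolding s_def lp_norm_trunc using q_pos by (intro powr_mono2) (auto intro: sum_nonneg)
    then show ?thesis
      using nonneg q_pos by (simp add: powr_mult powr_powr)
  qed
  define B :: "((nat \<Rightarrow> 'e) \<Rightarrow> 'k) set" where "B = {F. (\<forall>x\<in>V. \<forall>y\<in>V. F (x + y) = F x + F y) \<and>
    (\<forall>c. \<forall>x\<in>V. F (seq_smul smul c x) = c * F x) \<and> (\<exists>N. \<forall>y\<in>V. norm (F y) \<le> s N y)}"
  have topspace: "topspace (weak_lp smul X p) = V"
    by (simp add: weak_lp_def)
  have "B \<subseteq> dual (seq_smul smul) (weak_lp smul X p)"
  proof
    fix F assume F: "F \<in> B"
    then obtain N where N: "\<forall>y\<in>V. norm (F y) \<le> s N y"
      by (auto simp: B_def)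
    have F_diff: "F (x - y) = F x - F y" if "x \<in> V" "y \<in> V" for x y
    proof -
      have "F ((x - y) + y) = F (x - y) + F y"
        using F that seq_diff unfolding B_def by blast
      then show ?thesis by simp
    qed
    \<comment> \<open>The summand \<open>1\<close> keeps \<open>M\<close> positive when \<open>N = 0\<close>.\<close>
    define M where "M = real N powr (1 / q) + 1"
    have M: "M > 0"
      by (simp add: M_def add_nonneg_pos)
    have F_le: "norm (F y) \<le> M * \<rho> T_ball y" if y: "y \<in> V" for y
    proof -
      have "norm (F y) \<le> real N powr (1 / q) * \<rho> T_ball y"
        using bspec[OF N y] s_le[OF y, of N] by simp
      then show ?thesis
        using weak_seminorm_nonneg[OF T_ball_in_nhds_0 y] by (simp add: M_def algebra_simps)
    qed
    have small: "norm (F y) < \<epsilon>" if "y \<in> V" "\<rho> T_ball y < \<epsilon> / M" for \<epsilon> y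
    proof -
      have "M * \<rho> T_ball y < \<epsilon>"
        using that(2) M by (simp add: field_simps)
      then show ?thesis
        using F_le[OF that(1)] by simp
    qed
    have "\<exists>\<sigma>\<in>\<rho> ` \<N>. \<exists>\<delta>>0. \<forall>y\<in>V. \<sigma> y < \<delta> \<longrightarrow> norm (F y) < \<epsilon>" if "\<epsilon> > 0" for \<epsilon>
    proof (intro bexI exI conjI)
      show "\<epsilon> / M > 0" using that M by simp
      show "\<forall>y\<in>V. \<rho> T_ball y < \<epsilon> / M \<longrightarrow> norm (F y) < \<epsilon>"
        using small by blast
    qed (use T_ball_in_nhds_0 in blast)
    then have "continuous_map (weak_lp smul X p) euclidean F"
      unfolding weak_lp_def euclidean_eq_seminorm_topology
      by (subst continuous_map_seminorm_topology_iff[where f = F, OF directed_weak_seminorms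
          directed_seminorms_norm F_diff])
        auto
    then show "F \<in> dual (seq_smul smul) (weak_lp smul X p)"
      using F by (simp add: dual_def is_operator_def topspace B_def)
  qed
  moreover have "weak_star_bounded (weak_lp smul X p) B"
    unfolding weak_star_bounded_def topspace
  proof
    fix y assume y: "y \<in> V"
    have "norm (F y) \<le> lp_norm q (hat T y)" if F: "F \<in> B" for F
    proof -
      obtain N where "norm (F y) \<le> s N y"
        using F y by (auto simp: B_def)
      also have "\<dots> \<le> lp_norm q (hat T y)"
        unfolding s_def by (rule lp_norm_trunc_le[OF q_pos summ[OF y]])
      finally show ?thesis .
    qed
    then show "\<exists>M. \<forall>F\<in>B. norm (F y) \<le> M" by blast
  qed
  ultimately have "equicontinuous (weak_lp smul X p) B"
    using barrelled by (simp add: barrelled_def)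
  then obtain W where W: "openin (weak_lp smul X p) W" "0 \<in> W"
    and small: "\<And>y F. \<lbrakk>y \<in> W; F \<in> B\<rbrakk> \<Longrightarrow> dist (F y) (F 0) < 1"
    using V0 unfolding equicontinuous_def topspace by (meson zero_less_one)
  obtain U \<delta> where U: "U \<in> \<N>" "\<delta> > 0" "\<forall>y\<in>V. \<rho> U (y - 0) < \<delta> \<longrightarrow> y \<in> W"
    using W unfolding weak_lp_def P.openin_seminorm_topology_iff by blast
  have unit: "lp_norm q (hat T y) \<le> 1" if y: "y \<in> V" "\<rho> U y < \<delta>" for y
  proof (rule lp_norm_le_if_trunc_le(2)[OF q_pos])
    fix N
    obtain F where F: "\<And>x z. \<lbrakk>x \<in> V; z \<in> V\<rbrakk> \<Longrightarrow> F (x + z) = F x + F z"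
      "\<And>c x. x \<in> V \<Longrightarrow> F (seq_smul smul c x) = c * F x"
      "\<And>x. x \<in> V \<Longrightarrow> norm (F x) \<le> s N x" "norm (F y) = s N y"
      using seminorm_Hahn_Banach[where s = "s N", OF vector_space_seq_smul subspace_seqs s_add s_scale y(1)]
      by blast
    have "F \<in> B"
      unfolding B_def using F(1-3) by blast
    moreover have "y \<in> W"
      using U(3) y by simp
    moreover have "F 0 = 0"
      using F(1)[OF V0 V0] by simp
    ultimately show "lp_norm q (trunc N (hat T y)) \<le> 1"
      using small[of y F] F(4) by (simp add: s_def)
  qed
  have "hat_bounded U"
    using U(1,2) unit summ by (rule hat_boundedI)
  with U(1) show thesis
    by (rule that)
qed

end

theorem proposition17p5:
  fixes scaleE :: "'k::real_or_complex \<Rightarrow> 'e::ab_group_add \<Rightarrow> 'e"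
    and E :: "'e topology"
    and scaleL :: "'k \<Rightarrow> 'l::banach \<Rightarrow> 'l"
    and T :: "'e \<Rightarrow> 'l"
    and p q :: real
  assumes "1 \<le> p" and "p \<le> q"
    and "locally_convex_space scaleE E"
    and "banach_space_over scaleL"
    and "is_operator scaleE E scaleL euclidean T"
  shows "((\<exists>U\<in>closed_ac_nhds_0 scaleE E. U_qp_summing scaleE E U q p T) \<longleftrightarrow>
          (\<forall>y\<in>weakly_summable_seqs scaleE E p. hat T y \<in> strongly_summable_seqs q) \<and>
          continuous_map (weak_lp scaleE E p) (strong_lq q) (hat T))
      \<and> (continuous_map (weak_lp scaleE E p) (strong_lq q) (hat T) \<longrightarrow>
          qp_convergent scaleE E q p T)
      \<and> (barrelled (seq_smul scaleE) (weak_lp scaleE E p) \<and> qp_convergent scaleE E q p T \<longrightarrow>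
          continuous_map (weak_lp scaleE E p) (strong_lq q) (hat T))"
proof -
  interpret operator_on_weak_sequences scaleE E p scaleL T q
    using assms
    by (simp add: operator_on_weak_sequences_def operator_on_weak_sequences_axioms_def
        weak_sequences_def weak_sequences_axioms_def)
  have well_defined: "\<forall>y\<in>V. hat T y \<in> strongly_summable_seqs q"
    if "continuous_map (weak_lp scaleE E p) (strong_lq q) (hat T)"
    using that unfolding continuous_hat_iff hat_bounded_def by (auto simp: strongly_summable_seqs_def)
  moreover have "(\<exists>U\<in>\<N>. U_qp_summing scaleE E U q p T) \<longleftrightarrow>
      continuous_map (weak_lp scaleE E p) (strong_lq q) (hat T)"
    unfolding continuous_hat_iff using hat_bounded_iff_summing by blast
  moreover have "qp_convergent scaleE E q p T"
    if "\<forall>y\<in>V. hat T y \<in> strongly_summable_seqs q"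
    using that by (simp add: qp_convergent_def strongly_summable_seqs_def hat_def)
  moreover have "continuous_map (weak_lp scaleE E p) (strong_lq q) (hat T)"
    if "barrelled (seq_smul scaleE) (weak_lp scaleE E p)" "qp_convergent scaleE E q p T"
    unfolding continuous_hat_iff using barrelled_imp_hat_bounded[OF that] by blast
  ultimately show ?thesis by blast
qed

end
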